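(* For every $\gamma \in (0,1]$: (i) $R_\gamma(\mathcal E_{\rm D}) = \gamma/2$ if $\gamma \neq 1$, and $R_1(\mathcal E_{\rm D}) = 1$; (ii) $R_\gamma(\mathcal E_{\rm D>1}) = \dfrac{\gamma}{1+\sqrt{1-\gamma^2}}$; (iii) $R_\gamma(\mathcal E_{\rm U}) = \max\{\gamma/2,\ 2\gamma-1\}$.
   Context: Fix an atomless probability space with probability measure $\mathbb P$ and expectation $\mathbb E$ (so that every distribution on $[0,\infty)$ is the law of some random variable). An e-variable is a $[0,\infty]$-valued random variable $E$ with $\mathbb E[E]\le 1$; $\mathcal E_0$ is the set of all e-variables. For a nonempty set $\mathcal E\subseteq\mathcal E_0$ and $\gamma>0$, $R_\gamma(\mathcal E)=\sup_{E\in\mathcal E}\mathbb P(E\ge 1/\gamma)$. "Increasing" and "decreasing" are in the non-strict sense. $\mathcal E_{\rm D}$: the $E\in\mathcal E_0$ having a decreasing density on their support. Precisely, with $a\ge 0$ the left endpoint of the support of $E$, the law of $E$ is the sum of a (possibly zero) point mass at $a$ and a part with a density that is decreasing on $(a,\infty)$ (either part may be zero). $\mathcal E_{\rm D>1}$: the $E\in\mathcal E_0$ having a decreasing density over $[1,\infty)$. Precisely, the law of $E$ restricted to $[1,\infty)$ is the sum of a (possibly zero) point mass at $1$ and a part with a density decreasing on $(1,\infty)$; the law of $E$ on $[0,1)$ is arbitrary. $\mathcal E_{\rm U}$: the $E\in\mathcal E_0$ having a unimodal density on $[0,\infty)$. Precisely, there is $x\in[0,\infty)$ such that the law of $E$ is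 the sum of a (possibly zero) point mass at $x$ and a part with a density on $[0,\infty)$ that is increasing on $[0,x)$ and decreasing on $(x,\infty)$. *)

theory Defs
  imports "HOL-Probability.Probability"
begin

definition atomless :: "'a measure \<Rightarrow> bool" where
  "atomless M \<longleftrightarrow>
     (\<forall>A\<in>sets M. 0 < emeasure M A \<longrightarrow>
        (\<exists>B\<in>sets M. B \<subseteq> A \<and> 0 < emeasure M B \<and> emeasure M B < emeasure M A))"

definition evars :: "'a measure \<Rightarrow> ('a \<Rightarrow> ennreal) set" where
  "evars M = {E \<in> borel_measurable M. (\<integral>\<^sup>+ \<omega>. E \<omega> \<partial>M) \<le> 1}"

text \<open>For a probability measure \<open>M\<close> and a nonempty \<open>\<E>\<close> this is a supremum of a nonempty subset
  of the unit interval, so the supremum in the reals is the intended one.\<close>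

definition R :: "'a measure \<Rightarrow> real \<Rightarrow> ('a \<Rightarrow> ennreal) set \<Rightarrow> real" where
  "R M \<gamma> \<E> = (SUP E\<in>\<E>. measure M {\<omega> \<in> space M. E \<omega> \<ge> ennreal (1 / \<gamma>)})"

definition msupport :: "'b::topological_space measure \<Rightarrow> 'b set" where
  "msupport \<mu> = {x. \<forall>U. open U \<and> x \<in> U \<longrightarrow> 0 < emeasure \<mu> U}"

text \<open>On the Borel subsets of \<open>S\<close>, \<open>\<mu>\<close> is the sum of a point mass \<open>p\<close> at \<open>x\<close> and of the measure
  with Lebesgue density \<open>f\<close> on the nonnegative reals. The integral is restricted to \<open>{0..}\<close> because
  \<^term>\<open>ennreal\<close> sends every negative real to \<open>0\<close>. If \<open>\<infinity> \<in> S\<close> the equation forces \<open>\<mu> {\<infinity>} = 0\<close>,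
  which holds for the law of every e-variable.\<close>

definition atom_plus_density_on ::
  "ennreal set \<Rightarrow> ennreal measure \<Rightarrow> real \<Rightarrow> real \<Rightarrow> (real \<Rightarrow> real) \<Rightarrow> bool" where
  "atom_plus_density_on S \<mu> x p f \<longleftrightarrow>
     0 \<le> p \<and> f \<in> borel_measurable borel \<and> (\<forall>t. 0 \<le> f t) \<and>
     (\<forall>A\<in>sets borel. A \<subseteq> S \<longrightarrow>
        emeasure \<mu> A = ennreal p * indicator A (ennreal x)
          + (\<integral>\<^sup>+t\<in>{0..}. ennreal (f t) * indicator A (ennreal t) \<partial>lborel))"

text \<open>As \<open>a\<close> is the left endpoint of the support, the density below vanishes almost everywhere on
  \<open>{0..<a}\<close>.\<close>

definition evars_D :: "'a measure \<Rightarrow> ('a \<Rightarrow> ennreal) set" where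
  "evars_D M = {E \<in> evars M.
     \<exists>a p f. 0 \<le> a \<and> Inf (msupport (distr M borel E)) = ennreal a \<and>
       atom_plus_density_on UNIV (distr M borel E) a p f \<and> antimono_on {a<..} f}"

definition evars_D_gt1 :: "'a measure \<Rightarrow> ('a \<Rightarrow> ennreal) set" where
  "evars_D_gt1 M = {E \<in> evars M.
     \<exists>p f. atom_plus_density_on {1..} (distr M borel E) 1 p f \<and> antimono_on {1<..} f}"

definition evars_U :: "'a measure \<Rightarrow> ('a \<Rightarrow> ennreal) set" where
  "evars_U M = {E \<in> evars M.
     \<exists>x p f. 0 \<le> x \<and> atom_plus_density_on UNIV (distr M borel E) x p f \<and>
       mono_on {0..<x} f \<and> antimono_on {x<..} f}"

end

theory Submission
  imports Defs
begin

text \<open>Write \<open>t = 1 / \<gamma>\<close>, so that the quantity to be maximised is the tail \<open>P(E \<ge> t)\<close> under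
  \<open>E[E] \<le> 1\<close> and a shape constraint.

  The upper bounds are instances of linear duality. If \<open>\<alpha> + \<beta> * y - 1[y \<ge> t]\<close> has a
  nonnegative integral under the law of \<open>E\<close> and \<open>\<beta> \<ge> 0\<close>, then
  \<open>P(E \<ge> t) \<le> \<alpha> + \<beta> * E[E] \<le> \<alpha> + \<beta>\<close>; this is \<open>tail_le_of_certificate\<close>.
  Monotone densities are mixtures of uniform distributions having one endpoint fixed, so the
  certificate has to be nonnegative on average over such intervals only, not pointwise.
  On a stretch \<open>[x, \<infinity>)\<close> where the density decreases, \<open>\<alpha>\<close> and \<open>\<beta>\<close> are chosen such that the
  certificate vanishes at a point \<open>b \<ge> t\<close> and integrates to zero over \<open>[x, b]\<close>: it is then
  nonnegative on \<open>(x, t)\<close>, nonpositive on \<open>[t, b]\<close> and nonnegative on \<open>(b, \<infinity>)\<close>, and comparing the density with its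
  value at \<open>t\<close> gives \<open>decreasing_density_certificate\<close>. On a stretch \<open>[u, v)\<close> where the density
  increases, an affine function vanishing at the midpoint does the job
  (\<open>increasing_density_certificate\<close>).

  In the decreasing case \<open>x\<close> is the left endpoint \<open>a\<close> of the support, \<open>b = 2 * t - a\<close>, and the bound
  \<open>(1 - a) / (2 * (t - a))\<close> is largest at \<open>a = 0\<close>. If only the part on \<open>[1, \<infinity>)\<close> decreases,
  the certificate must be nonnegative on all of \<open>[0, 1)\<close>; \<open>\<alpha> = 0\<close>, \<open>x = 1\<close> and
  \<open>b = t + sqrt (t\<^sup>2 - 1)\<close> give the bound \<open>1 / b\<close>. In the unimodal case with mode \<open>x < t\<close> the
  certificate has midpoint zero on \<open>[0, x)\<close> and \<open>b = t + sqrt (t\<^sup>2 - t * x)\<close>; the bound obtained is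
  a ratio in \<open>x\<close> which is dominated by its values at \<open>x = 0\<close> and \<open>x = t\<close>
  (\<open>unimodal_tail_bound\<close>). A mode \<open>x \<ge> t\<close> is handled by two midpoint certificates, on
  \<open>[0, t)\<close> and on \<open>[t, x)\<close>.

  All bounds are attained by mixtures of a point mass and a uniform distribution
  (\<open>point_uniform_evar_exists\<close>). Such laws are realised as functions of a uniform variable, whose
  existence on an atomless space is \<open>atomless_uniform_variable\<close>: Zorn's lemma yields a chain of events
  whose probabilities exhaust \<open>[0, 1]\<close>, and the uniform variable records where a point enters the
  chain.\<close>

section \<open>Uniform variables on atomless probability spaces\<close>

text \<open>Inclusion is required to be strict in measure as well. Without this, a maximal chain could contain
  several events differing by null sets only, and a new event would have to be comparable with all of
  them.\<close>

definition strict_measure_chain :: "'a measure \<Rightarrow> 'a set set \<Rightarrow> bool" where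
  "strict_measure_chain M C \<longleftrightarrow> C \<subseteq> sets M \<and>
     (\<forall>A\<in>C. \<forall>B\<in>C. A = B \<or> (A \<subseteq> B \<and> measure M A < measure M B)
        \<or> (B \<subseteq> A \<and> measure M B < measure M A))"

definition maximal_measure_chain :: "'a measure \<Rightarrow> 'a set set \<Rightarrow> bool" where
  "maximal_measure_chain M C \<longleftrightarrow> strict_measure_chain M C \<and>
     (\<forall>D. strict_measure_chain M D \<and> C \<subseteq> D \<longrightarrow> D = C)"

lemma maximal_measure_chain_exists: "\<exists>C. maximal_measure_chain M C"
proof -
  have "\<exists>C\<in>Collect (strict_measure_chain M). \<forall>D\<in>Collect (strict_measure_chain M). C \<subseteq> D \<longrightarrow> D = C"
  proof (rule subset_Zorn')
    fix K assume K: "subset.chain (Collect (strict_measure_chain M)) K"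
    then have mem: "\<And>X. X \<in> K \<Longrightarrow> strict_measure_chain M X"
      and lin: "\<And>X Y. X \<in> K \<Longrightarrow> Y \<in> K \<Longrightarrow> X \<subseteq> Y \<or> Y \<subseteq> X"
      unfolding subset_chain_def by auto
    have "A = B \<or> (A \<subseteq> B \<and> measure M A < measure M B) \<or> (B \<subseteq> A \<and> measure M B < measure M A)"
      if "A \<in> \<Union>K" "B \<in> \<Union>K" for A B
    proof -
      from that obtain X Y where XY: "X \<in> K" "A \<in> X" "Y \<in> K" "B \<in> Y" by auto
      then obtain Z where "Z \<in> K" "A \<in> Z" "B \<in> Z" using lin[of X Y] by blast
      then show ?thesis using mem[of Z] unfolding strict_measure_chain_def by blast
    qed
    then show "\<Union>K \<in> Collect (strict_measure_chain M)"
      using mem unfolding strict_measure_chain_def by blast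
  qed
  then show ?thesis unfolding maximal_measure_chain_def by auto
qed

lemma maximal_measure_chain_memI:
  assumes C: "maximal_measure_chain M C" and A: "A \<in> sets M"
    and cmp: "\<And>B. B \<in> C \<Longrightarrow> (A \<subseteq> B \<and> measure M A < measure M B) \<or> (B \<subseteq> A \<and> measure M B < measure M A)"
  shows "A \<in> C"
proof -
  have "strict_measure_chain M (insert A C)"
    using C A cmp unfolding maximal_measure_chain_def strict_measure_chain_def by auto
  then have "insert A C = C" using C unfolding maximal_measure_chain_def by blast
  then show ?thesis by blast
qed

lemma measure_chain_subset:
  assumes "maximal_measure_chain M C" "A \<in> C" "B \<in> C" "measure M A \<le> measure M B"
  shows "A \<subseteq> B"
  using assms unfolding maximal_measure_chain_def strict_measure_chain_def by force

text \<open>Complementation turns statements about largest members below a level into statements about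
  smallest members above a level.\<close>

lemma maximal_measure_chain_compl:
  assumes "prob_space M" and C: "maximal_measure_chain M C"
  shows "maximal_measure_chain M ((\<lambda>A. space M - A) ` C)"
proof -
  interpret prob_space M by fact
  let ?c = "\<lambda>A. space M - A"
  have sm: "strict_measure_chain M (?c ` D)" if "strict_measure_chain M D" for D
    unfolding strict_measure_chain_def
  proof (intro conjI ballI)
    show "?c ` D \<subseteq> sets M" using that unfolding strict_measure_chain_def by auto
  next
    fix A B assume "A \<in> ?c ` D" "B \<in> ?c ` D"
    then obtain X Y where XY: "X \<in> D" "Y \<in> D" "A = ?c X" "B = ?c Y" by auto
    then have s: "X \<in> sets M" "Y \<in> sets M" using that unfolding strict_measure_chain_def by auto
    have "X = Y \<or> (X \<subseteq> Y \<and> measure M X < measure M Y) \<or> (Y \<subseteq> X \<and> measure M Y < measure M X)"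
      using that XY unfolding strict_measure_chain_def by blast
    then show "A = B \<or> (A \<subseteq> B \<and> measure M A < measure M B) \<or> (B \<subseteq> A \<and> measure M B < measure M A)"
      unfolding XY(3,4) prob_compl[OF s(1)] prob_compl[OF s(2)] by auto
  qed
  have inv: "?c ` ?c ` D = D" if "D \<subseteq> sets M" for D
  proof -
    have "?c (?c A) = A" if "A \<in> D" for A
      using that \<open>D \<subseteq> sets M\<close> sets.sets_into_space by blast
    then show ?thesis by (simp add: image_image cong: image_cong)
  qed
  have CC: "strict_measure_chain M C" "C \<subseteq> sets M"
    using C unfolding maximal_measure_chain_def strict_measure_chain_def by auto
  show ?thesis
    unfolding maximal_measure_chain_def
  proof (intro conjI allI impI)
    show "strict_measure_chain M (?c ` C)" using sm CC by simp
  next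
    fix D assume D: "strict_measure_chain M D \<and> ?c ` C \<subseteq> D"
    then have "?c ` ?c ` C \<subseteq> ?c ` D" by (intro image_mono) simp
    then have "C \<subseteq> ?c ` D" unfolding inv[OF CC(2)] .
    moreover have "strict_measure_chain M (?c ` D)" using sm D by simp
    ultimately have "?c ` D = C" using C unfolding maximal_measure_chain_def by blast
    then have "?c ` ?c ` D = ?c ` C" by (rule arg_cong)
    moreover have "?c ` ?c ` D = D" by (rule inv) (use D in \<open>simp add: strict_measure_chain_def\<close>)
    ultimately show "D = ?c ` C" by (metis (no_types))
  qed
qed

text \<open>If the supremum of the probabilities up to \<open>s\<close> is not attained in the chain, the union of a
  sequence approaching it is an event comparable with every member, hence belongs to the chain by
  maximality and attains the supremum after all.\<close>

lemma measure_chain_largest_below: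
  assumes "prob_space M" and C: "maximal_measure_chain M C" and s: "0 \<le> s"
  shows "\<exists>L\<in>C. measure M L \<le> s \<and> (\<forall>B\<in>C. measure M B \<le> s \<longrightarrow> B \<subseteq> L)"
proof -
  interpret prob_space M by fact
  have Csets: "C \<subseteq> sets M"
    using C unfolding maximal_measure_chain_def strict_measure_chain_def by auto
  define S where "S = {B\<in>C. prob B \<le> s}"
  define m where "m = Sup (prob ` S)"
  have ne: "S \<noteq> {}"
  proof
    assume "S = {}"
    then have "\<And>B. B \<in> C \<Longrightarrow> s < prob B" unfolding S_def by force
    then have "{} \<in> C" using s by (intro maximal_measure_chain_memI[OF C]) force+
    with \<open>S = {}\<close> s show False unfolding S_def by auto
  qed
  have bdd: "bdd_above (prob ` S)" by (rule bdd_aboveI[of _ 1]) auto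
  show ?thesis
  proof (cases "\<exists>L\<in>S. prob L = m")
    case True
    then obtain L where L: "L \<in> S" "prob L = m" by auto
    have "B \<subseteq> L" if "B \<in> C" "prob B \<le> s" for B
    proof -
      have "prob B \<le> m" unfolding m_def using that bdd by (intro cSup_upper) (auto simp: S_def)
      then show ?thesis using measure_chain_subset[OF C that(1)] L by (auto simp: S_def)
    qed
    then show ?thesis using L by (auto simp: S_def)
  next
    case False
    have lt: "prob B < m" if "B \<in> S" for B
      using that False cSup_upper[OF _ bdd, of "prob B"] unfolding m_def by force
    have "\<exists>B\<in>S. m - 1 / real (Suc n) < prob B" for n
    proof -
      have "m - 1 / real (Suc n) < Sup (prob ` S)" unfolding m_def by simp
      then show ?thesis using less_cSupD[of "prob ` S"] ne by auto
    qed
    then obtain B where B: "\<And>n. B n \<in> S" "\<And>n. m - 1 / real (Suc n) < prob (B n)" by metis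
    define L where "L = (\<Union>n. B n)"
    have Bs: "\<And>n. B n \<in> sets M" using B Csets by (auto simp: S_def)
    then have Ls: "L \<in> sets M" unfolding L_def by auto
    \<comment> \<open>Finite unions in a chain are members, so continuity from below applies to them.\<close>
    have part: "(\<Union>i\<le>n. B i) \<in> S" for n
    proof (induction n)
      case 0 show ?case using B by simp
    next
      case (Suc n)
      have "(\<Union>i\<le>n. B i) \<subseteq> B (Suc n) \<or> B (Suc n) \<subseteq> (\<Union>i\<le>n. B i)"
        using measure_chain_subset[OF C, of "\<Union>i\<le>n. B i" "B (Suc n)"]
          measure_chain_subset[OF C, of "B (Suc n)" "\<Union>i\<le>n. B i"] Suc B(1)[of "Suc n"]
        unfolding S_def by (cases "prob (\<Union>i\<le>n. B i) \<le> prob (B (Suc n))") auto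
      moreover have "(\<Union>i\<le>Suc n. B i) = B (Suc n) \<union> (\<Union>i\<le>n. B i)" by (simp add: atMost_Suc)
      ultimately have "(\<Union>i\<le>Suc n. B i) = B (Suc n) \<or> (\<Union>i\<le>Suc n. B i) = (\<Union>i\<le>n. B i)"
        by (metis Un_absorb1 Un_absorb2)
      then show ?case using Suc B(1)[of "Suc n"] by auto
    qed
    have "incseq (\<lambda>n. \<Union>i\<le>n. B i)" by (intro monoI UN_mono) auto
    then have "(\<lambda>n. prob (\<Union>i\<le>n. B i)) \<longlonglongrightarrow> prob (\<Union>n. \<Union>i\<le>n. B i)"
      using Bs by (intro finite_Lim_measure_incseq) auto
    moreover have "(\<Union>n. \<Union>i\<le>n. B i) = L" unfolding L_def by auto
    ultimately have "(\<lambda>n. prob (\<Union>i\<le>n. B i)) \<longlonglongrightarrow> prob L" by simp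
    then have le: "prob L \<le> m"
    proof (rule LIMSEQ_le_const2)
      show "\<exists>N. \<forall>n\<ge>N. prob (\<Union>i\<le>n. B i) \<le> m" using lt[OF part] less_imp_le by blast
    qed
    have approx: "m - 1 / real (Suc n) \<le> prob L" for n
    proof -
      have "prob (B n) \<le> prob L" by (rule finite_measure_mono[OF _ Ls]) (auto simp: L_def)
      then show ?thesis using B(2)[of n] by linarith
    qed
    have ge: "m \<le> prob L"
    proof (rule field_le_epsilon)
      fix e :: real assume "0 < e"
      then obtain n where "1 / real (Suc n) < e" using nat_approx_posE by blast
      then show "m \<le> prob L + e" using approx[of n] by linarith
    qed
    have ms: "m \<le> s" unfolding m_def using ne by (intro cSup_least) (auto simp: S_def)
    have below: "D \<subseteq> L" if "D \<in> S" for D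
    proof -
      have "0 < m - prob D" using lt[OF that] by simp
      then obtain n where "1 / real (Suc n) < m - prob D" using nat_approx_posE by blast
      then have "prob D \<le> prob (B n)" using B(2)[of n] by linarith
      then have "D \<subseteq> B n" using measure_chain_subset[OF C] B that by (auto simp: S_def)
      then show ?thesis unfolding L_def by auto
    qed
    have "L \<in> C"
    proof (rule maximal_measure_chain_memI[OF C Ls])
      fix D assume D: "D \<in> C"
      show "L \<subseteq> D \<and> prob L < prob D \<or> D \<subseteq> L \<and> prob D < prob L"
      proof (cases "prob D \<le> s")
        case True
        then show ?thesis using D below[of D] lt[of D] ge by (auto simp: S_def)
      next
        case False
        have "B n \<subseteq> D" for n
          using measure_chain_subset[OF C, of "B n" D] D B(1)[of n] False by (auto simp: S_def)
        then show ?thesis using False le ms unfolding L_def by auto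
      qed
    qed
    then show ?thesis using le ms below by (intro bexI[of _ L]) (auto simp: S_def)
  qed
qed

lemma measure_chain_smallest_above:
  assumes "prob_space M" and C: "maximal_measure_chain M C" and s: "s \<le> 1"
  shows "\<exists>G\<in>C. s \<le> measure M G \<and> (\<forall>B\<in>C. s \<le> measure M B \<longrightarrow> G \<subseteq> B)"
proof -
  interpret prob_space M by fact
  have Csets: "C \<subseteq> sets M"
    using C unfolding maximal_measure_chain_def strict_measure_chain_def by auto
  obtain L where L: "L \<in> (\<lambda>A. space M - A) ` C" "prob L \<le> 1 - s"
    "\<And>B. B \<in> (\<lambda>A. space M - A) ` C \<Longrightarrow> prob B \<le> 1 - s \<Longrightarrow> B \<subseteq> L"
    using measure_chain_largest_below[OF assms(1) maximal_measure_chain_compl[OF assms(1) C], of "1 - s"] s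
    by auto
  then obtain G where G: "G \<in> C" "L = space M - G" by auto
  have "G \<subseteq> B" if "B \<in> C" "s \<le> prob B" for B
  proof -
    have "space M - B \<subseteq> L"
      using that Csets prob_compl[of B] by (intro L(3)) auto
    moreover have "G \<subseteq> space M" using G(1) Csets sets.sets_into_space by blast
    ultimately show ?thesis using G(2) by blast
  qed
  then show ?thesis using G L(2) Csets prob_compl[of G] by (intro bexI[of _ G]) auto
qed

text \<open>A missing value \<open>s\<close> would leave a gap between the largest member below and the smallest member
  above. Atomlessness supplies an event strictly inside the gap, which contradicts maximality.\<close>

lemma maximal_measure_chain_attains:
  assumes "prob_space M" and "atomless M" and C: "maximal_measure_chain M C"
    and s: "0 \<le> s" "s \<le> 1"
  shows "\<exists>A\<in>C. measure M A = s"
proof (rule ccontr)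
  interpret prob_space M by fact
  assume no: "\<not> (\<exists>A\<in>C. measure M A = s)"
  have Csets: "C \<subseteq> sets M"
    using C unfolding maximal_measure_chain_def strict_measure_chain_def by auto
  obtain L where L: "L \<in> C" "prob L \<le> s" "\<And>B. B \<in> C \<Longrightarrow> prob B \<le> s \<Longrightarrow> B \<subseteq> L"
    using measure_chain_largest_below[OF assms(1) C s(1)] by auto
  obtain G where G: "G \<in> C" "s \<le> prob G" "\<And>B. B \<in> C \<Longrightarrow> s \<le> prob B \<Longrightarrow> G \<subseteq> B"
    using measure_chain_smallest_above[OF assms(1) C s(2)] by auto
  have LG: "L \<subseteq> G" using measure_chain_subset[OF C L(1) G(1)] L G by linarith
  have sets: "L \<in> sets M" "G \<in> sets M" using L G Csets by auto
  have diff: "prob (G - L) = prob G - prob L" using sets LG by (intro finite_measure_Diff) auto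
  have lt: "prob L < s" "s < prob G" using no L G by (metis order.order_iff_strict)+
  then have "0 < emeasure M (G - L)" using diff by (simp add: emeasure_eq_measure)
  then obtain B where B: "B \<in> sets M" "B \<subseteq> G - L" "0 < emeasure M B" "emeasure M B < emeasure M (G - L)"
    using assms(2) sets unfolding atomless_def by (meson sets.Diff)
  then have pB: "0 < prob B" "prob B < prob G - prob L"
    unfolding emeasure_eq_measure diff[symmetric] by (auto simp: ennreal_less_iff)
  have uni: "prob (L \<union> B) = prob L + prob B" using B sets by (intro finite_measure_Union) auto
  \<comment> \<open>No member lies strictly between \<open>L\<close> and \<open>G\<close>, so \<open>L \<union> B\<close> is comparable with all of them.\<close>
  have "L \<union> B \<in> C"
  proof (rule maximal_measure_chain_memI[OF C])
    show "L \<union> B \<in> sets M" using B sets by auto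
  next
    fix D assume D: "D \<in> C"
    show "L \<union> B \<subseteq> D \<and> prob (L \<union> B) < prob D \<or> D \<subseteq> L \<union> B \<and> prob D < prob (L \<union> B)"
    proof (cases "prob D \<le> s")
      case True
      then have "D \<subseteq> L" using L D by auto
      then show ?thesis using finite_measure_mono[of D L] sets uni pB by auto
    next
      case False
      then have "G \<subseteq> D" using G D by auto
      then have "prob G \<le> prob D" using D Csets by (intro finite_measure_mono) auto
      then show ?thesis using uni pB \<open>G \<subseteq> D\<close> LG B(2) by auto
    qed
  qed
  then have "prob (L \<union> B) \<le> s \<Longrightarrow> L \<union> B \<subseteq> L" "s \<le> prob (L \<union> B) \<Longrightarrow> G \<subseteq> L \<union> B"
    using L(3) G(3) by auto
  then have "prob (L \<union> B) \<le> prob L \<or> prob G \<le> prob (L \<union> B)"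
    using sets B(1) finite_measure_mono[of "L \<union> B" L] finite_measure_mono[of G "L \<union> B"]
    by (meson linear sets.Un)
  then show False using uni pB by auto
qed

text \<open>Let \<open>b s\<close> be a member of probability \<open>s\<close> of a maximal chain, so that \<open>b\<close> is increasing. The
  infimum of the rational \<open>s\<close> with \<open>\<omega> \<in> b s\<close> is at most \<open>t\<close> on \<open>b t\<close> and
  exceeds \<open>t\<close> outside every \<open>b x\<close> with \<open>x > t\<close>; rational levels keep the infimum countable and
  hence measurable.\<close>

lemma atomless_uniform_variable:
  assumes "prob_space M" and "atomless M"
  shows "\<exists>U. distributed M lborel U (indicator {0..1::real})"
proof -
  interpret prob_space M by fact
  obtain C where C: "maximal_measure_chain M C" using maximal_measure_chain_exists by blast
  have Csets: "C \<subseteq> sets M"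
    using C unfolding maximal_measure_chain_def strict_measure_chain_def by auto
  obtain b where b: "\<And>s. 0 \<le> s \<Longrightarrow> s \<le> 1 \<Longrightarrow> b s \<in> C \<and> prob (b s) = s"
    using maximal_measure_chain_attains[OF assms C] by metis
  have mono: "b r \<subseteq> b s" if "0 \<le> r" "r \<le> s" "s \<le> 1" for r s
    using that b[of r] b[of s] measure_chain_subset[OF C, of "b r" "b s"] by auto
  define Q where "Q = \<rat> \<inter> {0..1::real}"
  have Q: "countable Q" "Q \<noteq> {}" unfolding Q_def
    using countable_rat by (auto intro: countable_subset)
  have bs[measurable]: "b q \<in> sets M" if "q \<in> Q" for q using that b[of q] Csets by (auto simp: Q_def)
  define U where "U \<omega> = (INF q\<in>Q. if \<omega> \<in> b q then q else 1)" for \<omega>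
  have bdd: "bdd_below ((\<lambda>q. if \<omega> \<in> b q then q else 1) ` Q)" for \<omega>
    by (rule bdd_belowI[of _ 0]) (auto simp: Q_def)
  have Um: "U \<in> borel_measurable M"
    unfolding U_def using Q bdd by (intro borel_measurable_cINF) auto
  have less: "U \<omega> < x \<longleftrightarrow> (\<exists>q\<in>Q. (if \<omega> \<in> b q then q else 1) < x)" for \<omega> x
    unfolding U_def by (rule cINF_less_iff[OF Q(2) bdd])
  have "prob {\<omega>\<in>space M. U \<omega> \<le> t} = t" if t: "0 \<le> t" "t \<le> 1" for t
  proof (rule antisym)
    have meas: "{\<omega>\<in>space M. U \<omega> \<le> t} \<in> sets M" using Um by measurable
    have "b t \<subseteq> {\<omega>\<in>space M. U \<omega> \<le> t}"
    proof
      fix \<omega> assume w: "\<omega> \<in> b t"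
      then have "\<omega> \<in> space M" using b[OF t] Csets sets.sets_into_space by blast
      moreover have "U \<omega> \<le> t"
      proof (rule dense_ge)
        fix x assume "t < x"
        show "U \<omega> \<le> x"
        proof (cases "x \<le> 1")
          case True
          obtain q where q: "q \<in> \<rat>" "t < q" "q < x" using Rats_dense_in_real[OF \<open>t < x\<close>] by auto
          then have "q \<in> Q" "\<omega> \<in> b q" using t True w mono[of t q] by (auto simp: Q_def)
          then show ?thesis using less[of \<omega> x] q by force
        next
          case False
          then have "U \<omega> < x" unfolding less using Q t by (auto simp: Q_def)
          then show ?thesis by simp
        qed
      qed
      ultimately show "\<omega> \<in> {\<omega>\<in>space M. U \<omega> \<le> t}" by auto
    qed
    then show "t \<le> prob {\<omega>\<in>space M. U \<omega> \<le> t}"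
      using b[OF t] finite_measure_mono[OF _ meas, of "b t"] by auto
    show "prob {\<omega>\<in>space M. U \<omega> \<le> t} \<le> t"
    proof (rule dense_ge)
      fix x assume "t < x"
      show "prob {\<omega>\<in>space M. U \<omega> \<le> t} \<le> x"
      proof (cases "x \<le> 1")
        case True
        have "{\<omega>\<in>space M. U \<omega> \<le> t} \<subseteq> b x"
        proof clarify
          fix \<omega> assume "U \<omega> \<le> t"
          then have "U \<omega> < x" using \<open>t < x\<close> by simp
          then obtain q where "q \<in> Q" "\<omega> \<in> b q" "q < x" using less True by force
          then show "\<omega> \<in> b x" using mono[of q x] True by (auto simp: Q_def)
        qed
        moreover have "b x \<in> sets M" "prob (b x) = x" using b[of x] True t \<open>t < x\<close> Csets by auto
        ultimately show ?thesis using finite_measure_mono[of _ "b x"] by metis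
      next
        case False
        then show ?thesis using prob_le_1[of "{\<omega>\<in>space M. U \<omega> \<le> t}"] by linarith
      qed
    qed
  qed
  then have "distributed M lborel U (\<lambda>x. indicator {0..1} x / measure lborel {0..1::real})"
    using Um by (subst uniform_distributed_iff) (auto simp del: content_real_if)
  moreover have "(\<lambda>x. ennreal (indicator {0..1} x / measure lborel {0..1::real})) = indicator {0..1::real}"
    by (auto simp: indicator_def)
  ultimately have "distributed M lborel U (indicator {0..1})" by (rule back_subst)
  then show ?thesis by blast
qed

section \<open>Dual certificates for monotone densities\<close>

lemma affine_interval_integral:
  fixes \<alpha> \<beta> u v :: real
  assumes "u \<le> v"
  shows "integrable lborel (\<lambda>y. (\<alpha> + \<beta> * y) * indicator {u..v} y)"
    and "(\<integral>y. (\<alpha> + \<beta> * y) * indicator {u..v} y \<partial>lborel) = \<alpha> * (v - u) + \<beta> * (v\<^sup>2 - u\<^sup>2) / 2"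
proof -
  have "has_bochner_integral lborel (\<lambda>y. (\<alpha> + \<beta> * y) * indicator {u..v} y)
      ((\<alpha> * v + \<beta> * v\<^sup>2 / 2) - (\<alpha> * u + \<beta> * u\<^sup>2 / 2))"
    by (rule has_bochner_integral_FTC_Icc_real[where F="\<lambda>y. \<alpha> * y + \<beta> * y\<^sup>2 / 2"])
       (use assms in \<open>auto intro!: derivative_eq_intros continuous_intros\<close>)
  then show "integrable lborel (\<lambda>y. (\<alpha> + \<beta> * y) * indicator {u..v} y)"
    "(\<integral>y. (\<alpha> + \<beta> * y) * indicator {u..v} y \<partial>lborel) = \<alpha> * (v - u) + \<beta> * (v\<^sup>2 - u\<^sup>2) / 2"
    by (auto simp: has_bochner_integral_iff field_simps)
qed

lemma certificate_integral:
  fixes f :: "real \<Rightarrow> real"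
  assumes f0: "set_integrable lborel S f" and f1: "set_integrable lborel S (\<lambda>y. y * f y)"
    and S: "S \<in> sets borel"
  shows "set_integrable lborel S (\<lambda>y. (\<alpha> + \<beta> * y - indicator {t..} y) * f y)"
    and "(LINT y:S|lborel. (\<alpha> + \<beta> * y - indicator {t..} y) * f y) =
      \<alpha> * (LINT y:S|lborel. f y) + \<beta> * (LINT y:S|lborel. y * f y) - (LINT y:S \<inter> {t..}|lborel. f y)"
proof -
  have ft: "set_integrable lborel (S \<inter> {t..}) f" using f0 S by (rule_tac set_integrable_subset) auto
  have eq: "indicator S y *\<^sub>R ((\<alpha> + \<beta> * y - indicator {t..} y) * f y) =
    \<alpha> * (indicator S y *\<^sub>R f y) + \<beta> * (indicator S y *\<^sub>R (y * f y)) - indicator (S \<inter> {t..}) y *\<^sub>R f y" for y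
    by (auto simp: indicator_def algebra_simps)
  show "set_integrable lborel S (\<lambda>y. (\<alpha> + \<beta> * y - indicator {t..} y) * f y)"
    using f0 f1 ft unfolding set_integrable_def eq by auto
  show "(LINT y:S|lborel. (\<alpha> + \<beta> * y - indicator {t..} y) * f y) =
      \<alpha> * (LINT y:S|lborel. f y) + \<beta> * (LINT y:S|lborel. y * f y) - (LINT y:S \<inter> {t..}|lborel. f y)"
    using f0 f1 ft unfolding set_integrable_def set_lebesgue_integral_def eq by auto
qed

text \<open>The balance condition says that the certificate \<open>\<alpha> + \<beta> * y - 1[y \<ge> t]\<close> has integral zero
  over \<open>[x, b]\<close>. It is nonnegative on \<open>(x, t)\<close> and \<open>(b, \<infinity>)\<close> and nonpositive on \<open>[t, b]\<close>.
  Replacing \<open>f\<close> by the constant \<open>f t\<close> on \<open>(x, b]\<close> and by \<open>0\<close> beyond \<open>b\<close> therefore only lowers the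
  integral, and the lowered integral is zero.\<close>

lemma decreasing_density_certificate:
  fixes f :: "real \<Rightarrow> real"
  assumes anti: "antimono_on {x<..} f" and nonneg: "\<And>y. 0 \<le> f y"
    and f0: "set_integrable lborel {x..} f" and f1: "set_integrable lborel {x..} (\<lambda>y. y * f y)"
    and xt: "x < t" and tb: "t \<le> b" and \<beta>: "0 \<le> \<beta>" and hx: "0 \<le> \<alpha> + \<beta> * x"
    and hb: "\<alpha> + \<beta> * b = 1" and bal: "\<alpha> * (b - x) + \<beta> * (b\<^sup>2 - x\<^sup>2) / 2 = b - t"
  shows "0 \<le> (LINT y:{x..}|lborel. (\<alpha> + \<beta> * y - indicator {t..} y) * f y)"
proof -
  \<comment> \<open>the certificate weighted with the step function equal to \<open>f t\<close> up to \<open>b\<close>\<close>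
  define r where "r y = f t * ((\<alpha> + \<beta> * y) * indicator {x..b} y - (1 + 0 * y) * indicator {t..b} y)" for y
  note I1 = affine_interval_integral[of x b \<alpha> \<beta>] and I2 = affine_interval_integral[of t b 1 0]
  have r: "integrable lborel r" "integral\<^sup>L lborel r = 0"
    using I1 I2 bal xt tb unfolding r_def by (simp_all add: Bochner_Integration.integral_diff)
  have "integral\<^sup>L lborel r \<le> (\<integral>y. indicator {x..} y *\<^sub>R ((\<alpha> + \<beta> * y - indicator {t..} y) * f y) \<partial>lborel)"
  proof (rule integral_mono_AE[OF r(1)])
    show "integrable lborel (\<lambda>y. indicator {x..} y *\<^sub>R ((\<alpha> + \<beta> * y - indicator {t..} y) * f y))"
      using certificate_integral(1)[OF f0 f1] unfolding set_integrable_def by simp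
    have le: "r y \<le> indicator {x..} y *\<^sub>R ((\<alpha> + \<beta> * y - indicator {t..} y) * f y)" if "y \<noteq> x" for y
    proof -
      have dec: "f z \<le> f y" if "x < y" "y \<le> z" for y z
        using anti that unfolding monotone_on_def by auto
      have up: "\<alpha> + \<beta> * y \<le> \<alpha> + \<beta> * z" if "y \<le> z" for y z
        using \<beta> that by (simp add: mult_left_mono)
      consider "y < x" | "x < y" "y < t" | "t \<le> y" "y \<le> b" | "b < y" using \<open>y \<noteq> x\<close> by linarith
      then show ?thesis
      proof cases
        case 1
        then show ?thesis using xt by (simp add: r_def)
      next
        case 2
        then have "f t * (\<alpha> + \<beta> * y) \<le> f y * (\<alpha> + \<beta> * y)"
          using dec[of y t] up[of x y] hx by (intro mult_right_mono) auto
        then show ?thesis using 2 tb by (simp add: r_def mult.commute)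
      next
        case 3
        then have "(\<alpha> + \<beta> * y - 1) * f t \<le> (\<alpha> + \<beta> * y - 1) * f y"
          using dec[of t y] up[of y b] hb xt by (intro mult_left_mono_neg) auto
        then show ?thesis using 3 xt by (simp add: r_def mult.commute)
      next
        case 4
        then show ?thesis using xt tb up[of b y] hb nonneg[of y] by (simp add: r_def)
      qed
    qed
    show "AE y in lborel. r y \<le> indicator {x..} y *\<^sub>R ((\<alpha> + \<beta> * y - indicator {t..} y) * f y)"
      using AE_lborel_singleton[of x] by eventually_elim (rule le)
  qed
  then show ?thesis using r(2) unfolding set_lebesgue_integral_def by simp
qed

text \<open>The factor \<open>y - m\<close> changes sign at the midpoint \<open>m\<close>, so replacing \<open>f\<close> by the constant \<open>f m\<close>
  lowers the integral, and the lowered integral is zero by symmetry.\<close>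

lemma increasing_density_beyond_midpoint:
  fixes f :: "real \<Rightarrow> real"
  assumes mono: "mono_on {u..<v} f"
    and f0: "set_integrable lborel {u..<v} f" and f1: "set_integrable lborel {u..<v} (\<lambda>y. y * f y)"
  shows "0 \<le> (LINT y:{u..<v}|lborel. (y - (u + v) / 2) * f y)"
proof (cases "u < v")
  case uv: True
  define m where "m = (u + v) / 2"
  have m: "u \<le> m" "m < v" using uv by (auto simp: m_def)
  define r where "r y = f m * ((- m + 1 * y) * indicator {u..v} y)" for y
  have "- m * (v - u) + 1 * (v\<^sup>2 - u\<^sup>2) / 2 = 0"
    by (simp add: m_def power2_eq_square field_simps)
  then have r: "integrable lborel r" "integral\<^sup>L lborel r = 0"
    using affine_interval_integral[of u v "- m" 1] uv unfolding r_def by (auto simp del: mult_minus_left)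
  have eq: "indicator {u..<v} y *\<^sub>R ((y - m) * f y) =
    indicator {u..<v} y *\<^sub>R (y * f y) - m * (indicator {u..<v} y *\<^sub>R f y)" for y
    by (simp add: algebra_simps)
  have "integral\<^sup>L lborel r \<le> (\<integral>y. indicator {u..<v} y *\<^sub>R ((y - m) * f y) \<partial>lborel)"
  proof (rule integral_mono_AE[OF r(1)])
    show "integrable lborel (\<lambda>y. indicator {u..<v} y *\<^sub>R ((y - m) * f y))"
      using f0 f1 unfolding set_integrable_def eq by auto
    have le: "r y \<le> indicator {u..<v} y *\<^sub>R ((y - m) * f y)" if "y \<noteq> v" for y
    proof (cases "y \<in> {u..<v}")
      case True
      have "(y - m) * f m \<le> (y - m) * f y"
      proof (cases "m \<le> y")
        case True
        then show ?thesis using mono m \<open>y \<in> {u..<v}\<close>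
          by (intro mult_left_mono) (auto simp: monotone_on_def)
      next
        case False
        then show ?thesis using mono m \<open>y \<in> {u..<v}\<close>
          by (intro mult_left_mono_neg) (auto simp: monotone_on_def)
      qed
      then show ?thesis using True by (simp add: r_def algebra_simps)
    next
      case False
      then show ?thesis using that by (auto simp: r_def indicator_def)
    qed
    show "AE y in lborel. r y \<le> indicator {u..<v} y *\<^sub>R ((y - m) * f y)"
      using AE_lborel_singleton[of v] by eventually_elim (rule le)
  qed
  then show ?thesis using r(2) unfolding set_lebesgue_integral_def m_def by simp
qed (simp add: set_lebesgue_integral_def)

lemma increasing_density_certificate:
  fixes f :: "real \<Rightarrow> real"
  assumes mono: "mono_on {u..<v} f"
    and f0: "set_integrable lborel {u..<v} f" and f1: "set_integrable lborel {u..<v} (\<lambda>y. y * f y)"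
    and \<beta>: "0 \<le> \<beta>" and h: "\<And>y. y \<in> {u..<v} \<Longrightarrow> \<alpha> + \<beta> * y - indicator {t..} y = \<beta> * (y - (u + v) / 2)"
  shows "0 \<le> (LINT y:{u..<v}|lborel. (\<alpha> + \<beta> * y - indicator {t..} y) * f y)"
proof -
  have "(LINT y:{u..<v}|lborel. (\<alpha> + \<beta> * y - indicator {t..} y) * f y)
    = (LINT y:{u..<v}|lborel. \<beta> * ((y - (u + v) / 2) * f y))"
    by (rule set_lebesgue_integral_cong) (auto simp: h)
  then show ?thesis using \<beta> increasing_density_beyond_midpoint[OF mono f0 f1] by simp
qed

section \<open>Laws consisting of an atom and a density\<close>

text \<open>The defining equation for measures of sets extends to integrals by the standard induction over
  nonnegative measurable functions.\<close>

lemma atom_plus_density_nn_integral: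
  assumes apd: "atom_plus_density_on S \<mu> x p f" and sets: "sets \<mu> = sets borel"
    and S: "S \<in> sets borel" and g: "g \<in> borel_measurable borel"
  shows "(\<integral>\<^sup>+z. g z * indicator S z \<partial>\<mu>) = ennreal p * (g (ennreal x) * indicator S (ennreal x))
    + (\<integral>\<^sup>+t\<in>{0..}. ennreal (f t) * (g (ennreal t) * indicator S (ennreal t)) \<partial>lborel)"
  using g
proof (induction rule: borel_measurable_induct)
  case (cong u v)
  then show ?case by simp
next
  case (set A)
  have "(\<integral>\<^sup>+z. indicator A z * indicator S z \<partial>\<mu>) = emeasure \<mu> (A \<inter> S)"
    using set S sets by (simp add: indicator_inter_arith[symmetric])
  then show ?case using apd set S
    by (simp add: atom_plus_density_on_def indicator_inter_arith)
next
  case (mult u c)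
  have [measurable]: "u \<in> borel_measurable borel" "f \<in> borel_measurable borel" "S \<in> sets borel"
    "u \<in> borel_measurable \<mu>" "S \<in> sets \<mu>"
    using mult S apd sets by (auto simp: atom_plus_density_on_def cong: measurable_cong_sets)
  have "(\<integral>\<^sup>+t. ennreal (f t) * (c * u (ennreal t) * indicator S (ennreal t)) * indicator {0..} t \<partial>lborel)
    = c * (\<integral>\<^sup>+t. ennreal (f t) * (u (ennreal t) * indicator S (ennreal t)) * indicator {0..} t \<partial>lborel)"
    by (subst nn_integral_cmult[symmetric]) (auto simp: ac_simps)
  moreover have "(\<integral>\<^sup>+z. c * u z * indicator S z \<partial>\<mu>) = c * (\<integral>\<^sup>+z. u z * indicator S z \<partial>\<mu>)"
    by (subst nn_integral_cmult[symmetric]) (auto simp: ac_simps)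
  ultimately show ?case using mult.IH by (simp add: ring_distribs ac_simps)
next
  case (add u v)
  have [measurable]: "u \<in> borel_measurable borel" "v \<in> borel_measurable borel"
    "f \<in> borel_measurable borel" "S \<in> sets borel"
    "u \<in> borel_measurable \<mu>" "v \<in> borel_measurable \<mu>" "S \<in> sets \<mu>"
    using add S apd sets by (auto simp: atom_plus_density_on_def cong: measurable_cong_sets)
  have "(\<integral>\<^sup>+t. ennreal (f t) * ((v (ennreal t) + u (ennreal t)) * indicator S (ennreal t)) * indicator {0..} t \<partial>lborel)
    = (\<integral>\<^sup>+t. ennreal (f t) * (v (ennreal t) * indicator S (ennreal t)) * indicator {0..} t \<partial>lborel)
     + (\<integral>\<^sup>+t. ennreal (f t) * (u (ennreal t) * indicator S (ennreal t)) * indicator {0..} t \<partial>lborel)"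
    by (subst nn_integral_add[symmetric]) (auto simp: ring_distribs)
  moreover have "(\<integral>\<^sup>+z. (v z + u z) * indicator S z \<partial>\<mu>)
    = (\<integral>\<^sup>+z. v z * indicator S z \<partial>\<mu>) + (\<integral>\<^sup>+z. u z * indicator S z \<partial>\<mu>)"
    by (subst nn_integral_add[symmetric]) (auto simp: ring_distribs)
  ultimately show ?case using add.IH by (simp add: ring_distribs ac_simps)
next
  case (seq U)
  have [measurable]: "\<And>i. U i \<in> borel_measurable borel"
    "f \<in> borel_measurable borel" "S \<in> sets borel"
    "\<And>i. U i \<in> borel_measurable \<mu>" "S \<in> sets \<mu>"
    using seq S apd sets by (auto simp: atom_plus_density_on_def cong: measurable_cong_sets)
  have mono: "U i z \<le> U j z" if "i \<le> j" for i j z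
    using seq.hyps(3) that by (auto simp: incseq_def le_fun_def)
  have "(\<integral>\<^sup>+z. (SUP i. U i) z * indicator S z \<partial>\<mu>) = (\<integral>\<^sup>+z. (SUP i. U i z * indicator S z) \<partial>\<mu>)"
    by (simp add: image_comp SUP_mult_right_ennreal)
  also have "\<dots> = (SUP i. \<integral>\<^sup>+z. U i z * indicator S z \<partial>\<mu>)"
    by (intro nn_integral_monotone_convergence_SUP)
       (auto simp: incseq_def le_fun_def intro!: mult_right_mono mono)
  also have "\<dots> = (SUP i. ennreal p * (U i (ennreal x) * indicator S (ennreal x))
    + (\<integral>\<^sup>+t\<in>{0..}. ennreal (f t) * (U i (ennreal t) * indicator S (ennreal t)) \<partial>lborel))"
    using seq.IH by simp
  also have "\<dots> = (SUP i. ennreal p * (U i (ennreal x) * indicator S (ennreal x)))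
    + (SUP i. \<integral>\<^sup>+t\<in>{0..}. ennreal (f t) * (U i (ennreal t) * indicator S (ennreal t)) \<partial>lborel)"
    by (intro ennreal_SUP_add)
       (auto simp: incseq_def intro!: mult_right_mono mult_left_mono nn_integral_mono mono)
  also have "(SUP i. \<integral>\<^sup>+t\<in>{0..}. ennreal (f t) * (U i (ennreal t) * indicator S (ennreal t)) \<partial>lborel)
     = (\<integral>\<^sup>+t. (SUP i. ennreal (f t) * (U i (ennreal t) * indicator S (ennreal t)) * indicator {0..} t) \<partial>lborel)"
    by (intro nn_integral_monotone_convergence_SUP[symmetric])
       (auto simp: incseq_def le_fun_def intro!: mult_right_mono mult_left_mono mono)
  finally show ?case
    by (simp add: image_comp SUP_mult_right_ennreal SUP_mult_left_ennreal)
qed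

lemma atom_plus_density_on_subset:
  "atom_plus_density_on T \<mu> x p f \<Longrightarrow> S \<subseteq> T \<Longrightarrow> atom_plus_density_on S \<mu> x p f"
  by (auto simp: atom_plus_density_on_def)

text \<open>Real-valued bookkeeping for the part of the law on \<open>[s, \<infinity>]\<close>: the density and its first
  moment are integrable there because total mass and mean are at most one.\<close>

lemma evar_density_facts:
  assumes "prob_space M" and E: "E \<in> evars M"
    and apd: "atom_plus_density_on {ennreal s..} (distr M borel E) x p f" and s: "0 \<le> s" "s \<le> x"
  shows "set_integrable lborel {s..} f" and "set_integrable lborel {s..} (\<lambda>y. y * f y)"
    and "p * x + (LINT y:{s..}|lborel. y * f y) \<le> 1"
    and "\<And>t. s \<le> t \<Longrightarrow> measure M {\<omega>\<in>space M. ennreal t \<le> E \<omega>}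
           = p * indicator {t..} x + (LINT y:{t..}|lborel. f y)"
proof -
  interpret prob_space M by fact
  have p: "0 \<le> p" and f[measurable]: "f \<in> borel_measurable borel" and f0: "\<And>y. 0 \<le> f y"
    using apd by (auto simp: atom_plus_density_on_def)
  have Em[measurable]: "E \<in> borel_measurable M" and mean: "(\<integral>\<^sup>+\<omega>. E \<omega> \<partial>M) \<le> 1"
    using E by (auto simp: evars_def)
  have tail: "emeasure M {\<omega>\<in>space M. ennreal t \<le> E \<omega>}
      = ennreal (p * indicator {t..} x) + (\<integral>\<^sup>+y. ennreal (indicator {t..} y *\<^sub>R f y) \<partial>lborel)"
    if t: "s \<le> t" for t
  proof -
    have "emeasure (distr M borel E) {ennreal t..} = ennreal p * indicator {ennreal t..} (ennreal x)
      + (\<integral>\<^sup>+y\<in>{0..}. ennreal (f y) * indicator {ennreal t..} (ennreal y) \<partial>lborel)"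
      using apd t s unfolding atom_plus_density_on_def by (auto simp: ennreal_leI)
    moreover have "emeasure (distr M borel E) {ennreal t..} = emeasure M {\<omega>\<in>space M. ennreal t \<le> E \<omega>}"
      by (subst emeasure_distr) (auto intro!: arg_cong[where f="emeasure M"])
    moreover have "(\<integral>\<^sup>+y\<in>{0..}. ennreal (f y) * indicator {ennreal t..} (ennreal y) \<partial>lborel)
      = (\<integral>\<^sup>+y. ennreal (indicator {t..} y *\<^sub>R f y) \<partial>lborel)"
      using t s by (intro nn_integral_cong) (auto simp: indicator_def)
    moreover have "ennreal p * indicator {ennreal t..} (ennreal x) = ennreal (p * indicator {t..} x)"
      using t s by (auto simp: indicator_def)
    ultimately show ?thesis by simp
  qed
  have int: "integrable lborel (\<lambda>y. indicator {t..} y *\<^sub>R f y)" if "s \<le> t" for t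
  proof (rule integrableI_nonneg)
    have "(\<integral>\<^sup>+y. ennreal (indicator {t..} y *\<^sub>R f y) \<partial>lborel)
        \<le> emeasure M {\<omega>\<in>space M. ennreal t \<le> E \<omega>}"
      unfolding tail[OF that] by (rule add_increasing) simp_all
    also have "\<dots> \<le> 1" by (rule emeasure_le_1)
    finally show "(\<integral>\<^sup>+y. ennreal (indicator {t..} y *\<^sub>R f y) \<partial>lborel) < \<infinity>"
      by (simp add: order_le_less_trans)
  qed (use f0 in auto)
  then show "set_integrable lborel {s..} f" unfolding set_integrable_def by simp
  show "measure M {\<omega>\<in>space M. ennreal t \<le> E \<omega>} = p * indicator {t..} x + (LINT y:{t..}|lborel. f y)"
    if "s \<le> t" for t
  proof -
    have "(\<integral>\<^sup>+y. ennreal (indicator {t..} y *\<^sub>R f y) \<partial>lborel) = ennreal (LINT y:{t..}|lborel. f y)"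
      unfolding set_lebesgue_integral_def using int[OF that] f0 by (intro nn_integral_eq_integral) auto
    moreover have "0 \<le> (LINT y:{t..}|lborel. f y)"
      unfolding set_lebesgue_integral_def using f0 by (intro integral_nonneg_AE) auto
    ultimately show ?thesis using tail[OF that] p
      by (simp add: emeasure_eq_measure flip: ennreal_plus)
  qed
  have "(\<integral>\<^sup>+z. z * indicator {ennreal s..} z \<partial>distr M borel E)
     \<le> (\<integral>\<^sup>+z. z \<partial>distr M borel E)"
    by (intro nn_integral_mono) (auto simp: indicator_def)
  also have "\<dots> \<le> 1" using mean by (simp add: nn_integral_distr)
  finally have "ennreal p * (ennreal x * indicator {ennreal s..} (ennreal x))
    + (\<integral>\<^sup>+t\<in>{0..}. ennreal (f t) * (ennreal t * indicator {ennreal s..} (ennreal t)) \<partial>lborel) \<le> 1"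
    by (subst (asm) atom_plus_density_nn_integral[OF apd]) auto
  moreover have "(\<integral>\<^sup>+t\<in>{0..}. ennreal (f t) * (ennreal t * indicator {ennreal s..} (ennreal t)) \<partial>lborel)
    = (\<integral>\<^sup>+y. ennreal (indicator {s..} y *\<^sub>R (y * f y)) \<partial>lborel)"
    using s f0 by (intro nn_integral_cong) (auto simp: indicator_def ennreal_mult mult.commute)
  moreover have "ennreal p * (ennreal x * indicator {ennreal s..} (ennreal x)) = ennreal (p * x)"
    using s p by (auto simp: indicator_def ennreal_leI ennreal_mult)
  ultimately have first: "ennreal (p * x) + (\<integral>\<^sup>+y. ennreal (indicator {s..} y *\<^sub>R (y * f y)) \<partial>lborel) \<le> 1"
    by simp
  have pos: "0 \<le> indicator {s..} y *\<^sub>R (y * f y)" for y using s f0[of y] by (auto simp: indicator_def)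
  have int1: "integrable lborel (\<lambda>y. indicator {s..} y *\<^sub>R (y * f y))"
  proof (rule integrableI_nonneg)
    have "(\<integral>\<^sup>+y. ennreal (indicator {s..} y *\<^sub>R (y * f y)) \<partial>lborel)
        \<le> ennreal (p * x) + (\<integral>\<^sup>+y. ennreal (indicator {s..} y *\<^sub>R (y * f y)) \<partial>lborel)"
      by (rule add_increasing) simp_all
    also note first
    finally show "(\<integral>\<^sup>+y. ennreal (indicator {s..} y *\<^sub>R (y * f y)) \<partial>lborel) < \<infinity>"
      by (simp add: order_le_less_trans)
  qed (use pos in auto)
  then show "set_integrable lborel {s..} (\<lambda>y. y * f y)" unfolding set_integrable_def .
  have "(\<integral>\<^sup>+y. ennreal (indicator {s..} y *\<^sub>R (y * f y)) \<partial>lborel) = ennreal (LINT y:{s..}|lborel. y * f y)"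
    unfolding set_lebesgue_integral_def using int1 pos by (intro nn_integral_eq_integral) auto
  moreover have "0 \<le> (LINT y:{s..}|lborel. y * f y)"
    unfolding set_lebesgue_integral_def using pos by (intro integral_nonneg_AE) auto
  moreover have "0 \<le> p * x" using p s by simp
  ultimately show "p * x + (LINT y:{s..}|lborel. y * f y) \<le> 1"
    using first by (simp flip: ennreal_plus)
qed

text \<open>Weak duality: integrating the certificate over the part of the law on \<open>[s, \<infinity>]\<close> bounds the tail by
  \<open>\<alpha>\<close> times the mass plus \<open>\<beta>\<close> times the mean of that part. The first product
  equals \<open>\<alpha>\<close> if \<open>\<alpha>\<close> is zero or the mass is one, whence the alternative in the hypotheses.\<close>

lemma tail_le_of_certificate:
  assumes "prob_space M" and E: "E \<in> evars M"
    and apd: "atom_plus_density_on {ennreal s..} (distr M borel E) x p f" and s: "0 \<le> s" "s \<le> x" "s \<le> t"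
    and \<beta>: "0 \<le> \<beta>" and \<alpha>: "\<alpha> = 0 \<or> measure M {\<omega>\<in>space M. ennreal s \<le> E \<omega>} = 1"
    and atom: "0 \<le> \<alpha> + \<beta> * x - indicator {t..} x"
    and dens: "0 \<le> (LINT y:{s..}|lborel. (\<alpha> + \<beta> * y - indicator {t..} y) * f y)"
  shows "measure M {\<omega>\<in>space M. ennreal t \<le> E \<omega>} \<le> \<alpha> + \<beta>"
proof -
  note F = evar_density_facts[OF assms(1) E apd s(1,2)]
  have "{s..} \<inter> {t..} = {t..}" using s by auto
  then have D: "0 \<le> \<alpha> * (LINT y:{s..}|lborel. f y) + \<beta> * (LINT y:{s..}|lborel. y * f y) - (LINT y:{t..}|lborel. f y)"
    using dens certificate_integral(2)[OF F(1,2), of \<alpha> \<beta> t] by simp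
  have "0 \<le> p" using apd by (simp add: atom_plus_density_on_def)
  then have A: "0 \<le> p * (\<alpha> + \<beta> * x - indicator {t..} x)" using atom by simp
  have "\<alpha> * (p + (LINT y:{s..}|lborel. f y)) = \<alpha>" using \<alpha> F(4)[of s] s by auto
  moreover have "\<beta> * (p * x + (LINT y:{s..}|lborel. y * f y)) \<le> \<beta> * 1"
    using F(3) \<beta> by (rule mult_left_mono)
  ultimately show ?thesis using A D F(4)[OF s(3)] by (simp add: algebra_simps)
qed

section \<open>Tail bounds under shape constraints\<close>

text \<open>Each point below the infimum has an open null neighbourhood, and by second countability countably
  many of these cover the interval.\<close>

lemma emeasure_below_Inf_msupport:
  fixes \<mu> :: "ennreal measure"
  assumes sets: "sets \<mu> = sets borel"
  shows "emeasure \<mu> {..<Inf (msupport \<mu>)} = 0"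
proof -
  define F where "F = {U::ennreal set. open U \<and> emeasure \<mu> U = 0}"
  obtain F' where F': "F' \<subseteq> F" "countable F'" "\<Union>F' = \<Union>F"
    using Lindelof[of F] by (auto simp: F_def)
  have "{..<Inf (msupport \<mu>)} \<subseteq> \<Union>F"
  proof
    fix y assume "y \<in> {..<Inf (msupport \<mu>)}"
    then have "y \<notin> msupport \<mu>" by (metis Inf_lower lessThan_iff not_less)
    then show "y \<in> \<Union>F" unfolding msupport_def F_def by (auto simp: not_less)
  qed
  moreover have "\<Union>F' \<in> null_sets \<mu>"
    using F' sets by (intro null_sets_UN'[of F' "\<lambda>U. U", simplified]) (auto simp: F_def null_sets_def)
  ultimately show ?thesis using F'(3) sets by (metis null_setsD1 null_sets_subset lessThan_borel)
qed

text \<open>The left endpoint \<open>a\<close> of the support is at most the mean, so \<open>a \<le> 1 < t\<close>. Relative to \<open>a\<close>, the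
  density decreases from the origin on, and the certificate \<open>\<beta> * (y - a) - 1[y \<ge> t]\<close> with
  \<open>\<beta> = 1 / (2 * (t - a))\<close> bounds the tail of the shifted variable \<open>E - a\<close>.\<close>

lemma evars_D_tail_le:
  assumes "prob_space M" and E: "E \<in> evars_D M" and t: "1 < t"
  shows "measure M {\<omega>\<in>space M. ennreal t \<le> E \<omega>} \<le> 1 / (2 * t)"
proof -
  interpret prob_space M by fact
  from E obtain a p f where Ev: "E \<in> evars M" and a: "0 \<le> a"
    and Inf: "Inf (msupport (distr M borel E)) = ennreal a"
    and apd: "atom_plus_density_on UNIV (distr M borel E) a p f" and anti: "antimono_on {a<..} f"
    unfolding evars_D_def by auto
  have [measurable]: "E \<in> borel_measurable M" and mean: "(\<integral>\<^sup>+\<omega>. E \<omega> \<partial>M) \<le> 1"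
    using Ev by (auto simp: evars_def)
  have "emeasure (distr M borel E) {..<ennreal a} = 0"
    using emeasure_below_Inf_msupport[of "distr M borel E"] Inf by simp
  then have "emeasure M {\<omega>\<in>space M. \<not> ennreal a \<le> E \<omega>} = 0"
    by (subst (asm) emeasure_distr) (auto simp: not_le vimage_def Int_def conj_commute)
  then have ae: "AE \<omega> in M. ennreal a \<le> E \<omega>" by (subst AE_iff_measurable[OF _ refl]) auto
  then have full: "measure M {\<omega>\<in>space M. ennreal a \<le> E \<omega>} = 1" by (intro prob_eq_1[THEN iffD2]) auto
  have "(\<integral>\<^sup>+\<omega>. ennreal a \<partial>M) \<le> 1"
    using nn_integral_mono_AE[OF ae] mean by (rule order_trans)
  then have a1: "a \<le> 1" by (simp add: emeasure_space_1)
  define \<beta> where "\<beta> = 1 / (2 * (t - a))"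
  have ta: "a < t" using a1 t by simp
  have apd': "atom_plus_density_on {ennreal a..} (distr M borel E) a p f"
    by (rule atom_plus_density_on_subset[OF apd]) simp
  note F = evar_density_facts[OF assms(1) Ev apd' a order_refl]
  have b: "\<beta> * (2 * (t - a)) = 1" using ta by (simp add: \<beta>_def)
  have "measure M {\<omega>\<in>space M. ennreal t \<le> E \<omega>} \<le> - (\<beta> * a) + \<beta>"
  proof (rule tail_le_of_certificate[OF assms(1) Ev apd'])
    show "0 \<le> (LINT y:{a..}|lborel. (- (\<beta> * a) + \<beta> * y - indicator {t..} y) * f y)"
    proof (rule decreasing_density_certificate[OF anti _ F(1,2) ta])
      show "- (\<beta> * a) + \<beta> * (2 * t - a) = 1" using b by (simp add: algebra_simps)
      have "- (\<beta> * a) * (2 * t - a - a) + \<beta> * ((2 * t - a)\<^sup>2 - a\<^sup>2) / 2 = \<beta> * (2 * (t - a)) * (t - a)"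
        by (simp add: field_simps power2_eq_square)
      then show "- (\<beta> * a) * (2 * t - a - a) + \<beta> * ((2 * t - a)\<^sup>2 - a\<^sup>2) / 2 = 2 * t - a - t"
        using b by simp
      show "\<And>y. 0 \<le> f y" using apd by (simp add: atom_plus_density_on_def)
    qed (use ta in \<open>auto simp: \<beta>_def\<close>)
  qed (use a ta full in \<open>auto simp: \<beta>_def\<close>)
  also have "\<dots> \<le> 1 / (2 * t)"
  proof -
    have "a * 1 \<le> a * t" using a t by (intro mult_left_mono) auto
    then show ?thesis using ta t by (simp add: \<beta>_def field_simps)
  qed
  finally show ?thesis .
qed

text \<open>On \<open>[0, 1)\<close> nothing is known about the law, so the certificate \<open>\<alpha> + \<beta> * y\<close> must be nonnegative
  there. With \<open>\<alpha> = 0\<close>, the two conditions on the touching point \<open>b\<close> and the slope become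
  \<open>\<beta> = 1 / b\<close> and \<open>b\<^sup>2 - 2 * t * b + 1 = 0\<close>.\<close>

lemma evars_D_gt1_tail_le:
  assumes "prob_space M" and E: "E \<in> evars_D_gt1 M" and t: "1 < t"
  shows "measure M {\<omega>\<in>space M. ennreal t \<le> E \<omega>} \<le> 1 / (t + sqrt (t\<^sup>2 - 1))"
proof -
  from E obtain p f where Ev: "E \<in> evars M"
    and apd: "atom_plus_density_on {ennreal 1..} (distr M borel E) 1 p f" and anti: "antimono_on {1<..} f"
    unfolding evars_D_gt1_def by auto
  note F = evar_density_facts[OF assms(1) Ev apd zero_le_one order_refl]
  define b where "b = t + sqrt (t\<^sup>2 - 1)"
  have "0 \<le> t\<^sup>2 - 1" using t by (simp add: one_le_power)
  then have b: "t \<le> b" "(b - t)\<^sup>2 = t\<^sup>2 - 1" by (simp_all add: b_def)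
  have "measure M {\<omega>\<in>space M. ennreal t \<le> E \<omega>} \<le> 0 + 1 / b"
  proof (rule tail_le_of_certificate[OF assms(1) Ev apd])
    show "0 \<le> (LINT y:{1..}|lborel. (0 + 1 / b * y - indicator {t..} y) * f y)"
    proof (rule decreasing_density_certificate[OF anti _ F(1,2) t])
      have "b\<^sup>2 - 1 = (b - t) * (2 * b)" using b(2) by (simp add: power2_eq_square algebra_simps)
      then show "0 * (b - 1) + 1 / b * (b\<^sup>2 - 1\<^sup>2) / 2 = b - t" using b t by simp
      show "\<And>y. 0 \<le> f y" using apd by (simp add: atom_plus_density_on_def)
    qed (use b t in auto)
  qed (use b t in auto)
  then show ?thesis by (simp add: b_def)
qed

text \<open>With \<open>x = t * (1 - s\<^sup>2)\<close> as the mode, the left-hand side interpolates between the bound \<open>1 / (2 * t)\<close>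
  for mode \<open>0\<close> (at \<open>s = 1\<close>) and the bound \<open>2 / t - 1\<close> for mode \<open>t\<close> (at \<open>s = 0\<close>). The numerator
  is a convex combination of its two end values with weights \<open>1 - s\<^sup>2\<close> and \<open>s\<^sup>2\<close>, and
  \<open>s\<^sup>2 \<le> s\<close> lets the denominator absorb it.\<close>

lemma unimodal_tail_bound:
  fixes s t :: real
  assumes t: "1 \<le> t" and s: "0 \<le> s" "s \<le> 1"
  shows "(2 - t * (1 - s\<^sup>2)) / (t * (1 + s)\<^sup>2) \<le> max (1 / (2 * t)) (2 / t - 1)"
proof -
  define m where "m = max (1 / (2 * t)) (2 / t - 1) * t"
  have "1 / (2 * t) * t \<le> m" "(2 / t - 1) * t \<le> m"
    unfolding m_def by (rule mult_right_mono; use t in simp)+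
  moreover have "1 / (2 * t) * t = 1 / 2" "(2 / t - 1) * t = 2 - t" using t by (simp_all add: field_simps)
  ultimately have m: "1 / 2 \<le> m" "2 - t \<le> m" by simp_all
  have s2: "s\<^sup>2 \<le> s" "0 \<le> s\<^sup>2" using s by (simp_all add: power2_eq_square mult_left_le)
  have "2 - t * (1 - s\<^sup>2) = (2 - t) * (1 - s\<^sup>2) + 2 * s\<^sup>2" by (simp add: algebra_simps)
  also have "\<dots> \<le> m * (1 - s\<^sup>2) + (4 * m) * s\<^sup>2"
    using m s s2 by (intro add_mono mult_right_mono) auto
  also have "\<dots> = m * (1 + 3 * s\<^sup>2)" by (simp add: algebra_simps)
  also have "\<dots> \<le> m * (1 + s)\<^sup>2"
    using m s s2 by (intro mult_left_mono) (auto simp: power2_eq_square algebra_simps)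
  finally have "2 - t * (1 - s\<^sup>2) \<le> max (1 / (2 * t)) (2 / t - 1) * (t * (1 + s)\<^sup>2)"
    by (simp add: m_def mult.assoc)
  moreover have "0 < t * (1 + s)\<^sup>2" using t s by simp
  ultimately show ?thesis by (simp add: pos_divide_le_eq)
qed

text \<open>For a mode \<open>x < t\<close> the extremal laws mix uniform distributions on \<open>[0, x]\<close> and on \<open>[x, b]\<close>, and
  the certificate integrates to zero over both intervals. For a mode \<open>x \<ge> t\<close> they mix uniform
  distributions on \<open>[0, x]\<close> and on \<open>[t, x]\<close>; the certificate integrates to zero over \<open>[0, t]\<close> and over
  \<open>[t, x]\<close> and gives the bound \<open>(2 - t) / x\<close>, which for \<open>t \<le> 2\<close> is largest at \<open>x = t\<close>.\<close>

lemma evars_U_tail_le: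
  assumes "prob_space M" and E: "E \<in> evars_U M" and t: "1 \<le> t"
  shows "measure M {\<omega>\<in>space M. ennreal t \<le> E \<omega>} \<le> max (1 / (2 * t)) (2 / t - 1)"
proof -
  interpret prob_space M by fact
  from E obtain x p f where Ev: "E \<in> evars M" and x: "0 \<le> x"
    and apd0: "atom_plus_density_on UNIV (distr M borel E) x p f"
    and mono: "mono_on {0..<x} f" and anti: "antimono_on {x<..} f"
    unfolding evars_U_def by auto
  have apd: "atom_plus_density_on {ennreal 0..} (distr M borel E) x p f"
    by (rule atom_plus_density_on_subset[OF apd0]) simp
  have f0: "\<And>y. 0 \<le> f y" using apd by (simp add: atom_plus_density_on_def)
  note F = evar_density_facts[OF assms(1) Ev apd order_refl x]
  have sub0: "set_integrable lborel A f" and sub1: "set_integrable lborel A (\<lambda>y. y * f y)"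
    if "A \<in> sets borel" "A \<subseteq> {0..}" for A
    using F(1,2) that by (auto intro: set_integrable_subset)
  have full: "measure M {\<omega>\<in>space M. ennreal 0 \<le> E \<omega>} = 1" by (simp add: prob_space)
  let ?h = "\<lambda>\<alpha> \<beta> y. (\<alpha> + \<beta> * y - indicator {t..} y) * f y"
  have split: "(LINT y:A \<union> B|lborel. ?h \<alpha> \<beta> y) = (LINT y:A|lborel. ?h \<alpha> \<beta> y) + (LINT y:B|lborel. ?h \<alpha> \<beta> y)"
    if "A \<in> sets borel" "B \<in> sets borel" "A \<inter> B = {}" "A \<subseteq> {0..}" "B \<subseteq> {0..}" for A B \<alpha> \<beta>
    using that by (intro set_integral_Un certificate_integral(1) sub0 sub1) auto
  show ?thesis
  proof (cases "x < t")
    case True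
    \<comment> \<open>In terms of \<open>s\<close> the touching point \<open>t + sqrt (t\<^sup>2 - t * x)\<close> is free of roots.\<close>
    define s where "s = sqrt (1 - x / t)"
    have s: "0 \<le> s" "s \<le> 1" and xs: "x = t * (1 - s\<^sup>2)"
      using True x t by (auto simp: s_def field_simps)
    define b where "b = t * (1 + s)"
    define \<beta> where "\<beta> = 1 / (b - x / 2)"
    define \<alpha> where "\<alpha> = - (\<beta> * x / 2)"
    have tb: "t \<le> b" using s t by (simp add: b_def algebra_simps)
    have pos: "0 < b - x / 2" using tb True x by simp
    have \<beta>: "0 \<le> \<beta>" "\<beta> * (b - x / 2) = 1" using pos by (auto simp: \<beta>_def)
    have dec: "0 \<le> (LINT y:{x..}|lborel. ?h \<alpha> \<beta> y)"
    proof (rule decreasing_density_certificate[OF anti f0 sub0 sub1 True tb \<beta>(1)])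
      show "\<alpha> + \<beta> * b = 1" using \<beta>(2) by (simp add: \<alpha>_def algebra_simps)
      have "b * (b - x) = 2 * ((b - x / 2) * (b - t))"
        unfolding b_def xs by (simp add: field_simps power2_eq_square)
      then have "\<beta> * (b * (b - x)) / 2 = \<beta> * (b - x / 2) * (b - t)" by simp
      then have "\<beta> * (b * (b - x)) / 2 = b - t" using \<beta>(2) by simp
      then show "\<alpha> * (b - x) + \<beta> * (b\<^sup>2 - x\<^sup>2) / 2 = b - t"
        by (simp add: \<alpha>_def power2_eq_square field_simps)
    qed (use x \<beta> in \<open>auto simp: \<alpha>_def\<close>)
    have inc: "0 \<le> (LINT y:{0..<x}|lborel. ?h \<alpha> \<beta> y)"
      using True by (intro increasing_density_certificate mono sub0 sub1 \<beta>)
        (auto simp: \<alpha>_def algebra_simps)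
    have un: "{0..<x} \<union> {x..} = {0..}" using x by auto
    have "measure M {\<omega>\<in>space M. ennreal t \<le> E \<omega>} \<le> \<alpha> + \<beta>"
    proof (rule tail_le_of_certificate[OF assms(1) Ev apd])
      show "0 \<le> (LINT y:{0..}|lborel. ?h \<alpha> \<beta> y)"
        unfolding un[symmetric] using x inc dec by (subst split) auto
    qed (use x t True full \<beta> in \<open>auto simp: \<alpha>_def\<close>)
    also have "\<dots> = (1 - x / 2) / (b - x / 2)" by (simp add: \<alpha>_def \<beta>_def diff_divide_distrib)
    also have "\<dots> = (2 * (1 - x / 2)) / (2 * (b - x / 2))" by (rule mult_divide_mult_cancel_left[symmetric]) simp
    also have "\<dots> = (2 - x) / (2 * b - x)" by (simp add: right_diff_distrib)
    also have "2 * b - x = t * (1 + s)\<^sup>2" by (simp add: b_def xs power2_eq_square algebra_simps)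
    also have "(2 - x) / (t * (1 + s)\<^sup>2) \<le> max (1 / (2 * t)) (2 / t - 1)"
      unfolding xs using unimodal_tail_bound[OF t s] .
    finally show ?thesis .
  next
    case False
    then have xt: "t \<le> x" "0 < x" using t by auto
    define \<beta> where "\<beta> = 2 / x"
    define \<alpha> where "\<alpha> = - (t / x)"
    have \<beta>: "0 \<le> \<beta>" using x by (simp add: \<beta>_def)
    \<comment> \<open>With zeros at \<open>t / 2\<close> and \<open>(t + x) / 2\<close> the certificate is nonnegative from \<open>x\<close> on.\<close>
    have beyond: "0 \<le> \<alpha> + \<beta> * y - indicator {t..} y" if "x \<le> y" for y
      using that xt by (auto simp: \<alpha>_def \<beta>_def field_simps indicator_def)
    have low: "0 \<le> (LINT y:{0..<t}|lborel. ?h \<alpha> \<beta> y)"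
      using xt by (intro increasing_density_certificate sub0 sub1 \<beta> monotone_on_subset[OF mono])
        (auto simp: \<alpha>_def \<beta>_def field_simps)
    have mid: "0 \<le> (LINT y:{t..<x}|lborel. ?h \<alpha> \<beta> y)"
      using xt t by (intro increasing_density_certificate sub0 sub1 \<beta> monotone_on_subset[OF mono])
        (auto simp: \<alpha>_def \<beta>_def field_simps)
    have high: "0 \<le> (LINT y:{x..}|lborel. ?h \<alpha> \<beta> y)"
      unfolding set_lebesgue_integral_def using beyond f0
      by (intro integral_nonneg_AE) (auto simp: indicator_def)
    have un: "{0..<t} \<union> ({t..<x} \<union> {x..}) = {0..}" using xt t by auto
    have "measure M {\<omega>\<in>space M. ennreal t \<le> E \<omega>} \<le> \<alpha> + \<beta>"
    proof (rule tail_le_of_certificate[OF assms(1) Ev apd])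
      show "0 \<le> (LINT y:{0..}|lborel. ?h \<alpha> \<beta> y)"
        unfolding un[symmetric] using xt t low mid high
        by (subst split; (subst split)?) auto
    qed (use x t full \<beta> beyond[of x] in auto)
    also have "\<alpha> + \<beta> = (2 - t) / x" by (simp add: \<alpha>_def \<beta>_def diff_divide_distrib)
    also have "\<dots> \<le> max (1 / (2 * t)) (2 / t - 1)"
    proof (cases "t \<le> 2")
      case True
      then have "(2 - t) / x \<le> (2 - t) / t" using xt t by (intro divide_left_mono) auto
      also have "\<dots> = 2 / t - 1" using t by (simp add: field_simps)
      finally show ?thesis by simp
    next
      case False
      then have "(2 - t) / x \<le> 0" using xt by (simp add: divide_nonpos_pos)
      also have "0 \<le> 1 / (2 * t)" using t by simp
      finally show ?thesis by simp
    qed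
    finally show ?thesis .
  qed
qed

section \<open>Mixtures of a point mass and a uniform law\<close>

text \<open>A uniform variable \<open>U\<close> decides between the two components: on \<open>U \<le> q\<close> it is rescaled affinely to
  \<open>[u, v]\<close>, otherwise the value is \<open>c\<close>.\<close>

lemma point_uniform_mixture_exists:
  assumes "prob_space M" and "atomless M" and q: "0 \<le> q" "q \<le> 1"
    and c: "0 \<le> c" and uv: "0 \<le> u" "u < v"
  shows "\<exists>E\<in>borel_measurable M. atom_plus_density_on UNIV (distr M borel E) c (1 - q)
    (\<lambda>y. q / (v - u) * indicator {u..v} y)"
proof (cases "q = 0")
  case True
  interpret prob_space M by fact
  have "emeasure (distr M borel (\<lambda>_. ennreal c)) A = indicator A (ennreal c)" if "A \<in> sets borel" for A
    using that by (subst emeasure_distr) (auto simp: indicator_def emeasure_space_1)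
  then show ?thesis using True
    by (intro bexI[of _ "\<lambda>_. ennreal c"]) (auto simp: atom_plus_density_on_def)
next
  case False
  interpret prob_space M by fact
  obtain U where U: "distributed M lborel U (indicator {0..1::real})"
    using atomless_uniform_variable[OF assms(1,2)] by auto
  have [measurable]: "U \<in> borel_measurable M" using distributed_measurable[OF U] by simp
  define k where "k = (v - u) / q"
  have k: "0 < k" "k * q = v - u" using False q uv by (auto simp: k_def)
  define E where "E \<omega> = ennreal (if U \<omega> \<le> q then u + k * U \<omega> else c)" for \<omega>
  have [measurable]: "E \<in> borel_measurable M" unfolding E_def by measurable
  have "emeasure (distr M borel E) A = ennreal (1 - q) * indicator A (ennreal c)
      + (\<integral>\<^sup>+y\<in>{0..}. ennreal (q / (v - u) * indicator {u..v} y) * indicator A (ennreal y) \<partial>lborel)"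
    if [measurable]: "A \<in> sets borel" for A
  proof -
    let ?g = "\<lambda>z. indicator A (ennreal (if z \<le> q then u + k * z else c)) :: ennreal"
    have "emeasure (distr M borel E) A = (\<integral>\<^sup>+z. indicator A z \<partial>distr M borel E)" by simp
    also have "\<dots> = (\<integral>\<^sup>+\<omega>. ?g (U \<omega>) \<partial>M)" by (subst nn_integral_distr) (auto simp: E_def)
    also have "\<dots> = (\<integral>\<^sup>+z. indicator {0..1} z * ?g z \<partial>lborel)"
      by (rule distributed_nn_integral[OF U, symmetric]) measurable
    also have "\<dots> = (\<integral>\<^sup>+z. indicator {0..q} z * indicator A (ennreal (u + k * z))
        + indicator {q<..1} z * indicator A (ennreal c) \<partial>lborel)"
      using q by (intro nn_integral_cong) (auto simp: indicator_def)
    also have "\<dots> = (\<integral>\<^sup>+z. indicator {0..q} z * indicator A (ennreal (u + k * z)) \<partial>lborel)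
        + (\<integral>\<^sup>+z. indicator A (ennreal c) * indicator {q<..1} z \<partial>lborel)"
      by (subst nn_integral_add[symmetric]) (auto simp: mult.commute)
    also have "(\<integral>\<^sup>+z. indicator A (ennreal c) * indicator {q<..1} z \<partial>lborel)
        = ennreal (1 - q) * indicator A (ennreal c)"
      using q by (subst nn_integral_cmult_indicator) (auto simp: mult.commute)
    also have "(\<integral>\<^sup>+z. indicator {0..q} z * indicator A (ennreal (u + k * z)) \<partial>lborel)
      = (\<integral>\<^sup>+y\<in>{0..}. ennreal (q / (v - u) * indicator {u..v} y) * indicator A (ennreal y) \<partial>lborel)"
    proof -
      have scale: "u \<le> u + k * z \<longleftrightarrow> 0 \<le> z" "u + k * z \<le> v \<longleftrightarrow> z \<le> q" for z
      proof -
        show "u \<le> u + k * z \<longleftrightarrow> 0 \<le> z" using k by (simp add: zero_le_mult_iff)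
        have "u + k * z \<le> v \<longleftrightarrow> k * z \<le> k * q" using k by auto
        also have "\<dots> \<longleftrightarrow> z \<le> q" using k(1) by (rule mult_le_cancel_left_pos)
        finally show "u + k * z \<le> v \<longleftrightarrow> z \<le> q" .
      qed
      have kq: "k * (q / (v - u)) = 1" using k uv False by (simp add: k_def)
      have pt: "ennreal k * (ennreal (q / (v - u) * indicator {u..v} (u + k * z))
          * indicator A (ennreal (u + k * z)) * indicator {0..} (u + k * z))
        = indicator {0..q} z * indicator A (ennreal (u + k * z))" for z
      proof (cases "0 \<le> z \<and> z \<le> q")
        case True
        then have "0 \<le> u + k * z" "indicator {u..v} (u + k * z) = (1::real)" using scale[of z] uv by auto
        moreover have "ennreal k * ennreal (q / (v - u)) = 1"
          using kq k by (simp flip: ennreal_mult')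
        ultimately show ?thesis using True by (simp add: mult.assoc[symmetric])
      next
        case False
        then have "indicator {u..v} (u + k * z) = (0::real)" using scale[of z] by (auto simp: indicator_def)
        then show ?thesis using False by (auto simp: indicator_def)
      qed
      show ?thesis
        by (rule sym, subst nn_integral_real_affine[where c=k and t=u])
           (use k in \<open>auto simp: pt nn_integral_cmult[symmetric] simp del: times_divide_eq_left times_divide_eq_right\<close>)
    qed
    finally show ?thesis by (simp add: add.commute)
  qed
  then show ?thesis using q uv
    by (intro bexI[of _ E]) (auto simp: atom_plus_density_on_def)
qed

lemma point_uniform_evar_exists:
  assumes M: "prob_space M" "atomless M" and q: "0 \<le> q" "q \<le> 1"
    and c: "0 \<le> c" and uv: "0 \<le> u" "u < v" and t: "u \<le> t" "t \<le> v"
    and mean: "(1 - q) * c + q * (u + v) / 2 \<le> 1"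
  shows "\<exists>E\<in>evars M. atom_plus_density_on UNIV (distr M borel E) c (1 - q)
      (\<lambda>y. q / (v - u) * indicator {u..v} y) \<and>
    measure M {\<omega>\<in>space M. ennreal t \<le> E \<omega>} = (1 - q) * indicator {t..} c + q * (v - t) / (v - u)"
proof -
  obtain E where E[measurable]: "E \<in> borel_measurable M"
    and apd: "atom_plus_density_on UNIV (distr M borel E) c (1 - q) (\<lambda>y. q / (v - u) * indicator {u..v} y)"
    using point_uniform_mixture_exists[OF M q c uv] by blast
  define d where "d = q / (v - u)"
  have d: "0 \<le> d" using q uv by (simp add: d_def)
  note I = affine_interval_integral[of u v 0 d]
  have "(\<integral>\<^sup>+\<omega>. E \<omega> \<partial>M) = (\<integral>\<^sup>+z. z * indicator UNIV z \<partial>distr M borel E)"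
    by (simp add: nn_integral_distr)
  also have "\<dots> = ennreal (1 - q) * ennreal c
      + (\<integral>\<^sup>+y\<in>{0..}. ennreal (d * indicator {u..v} y) * ennreal y \<partial>lborel)"
    using apd by (subst atom_plus_density_nn_integral[OF apd]) (auto simp: d_def)
  also have "(\<integral>\<^sup>+y\<in>{0..}. ennreal (d * indicator {u..v} y) * ennreal y \<partial>lborel)
      = (\<integral>\<^sup>+y. ennreal ((0 + d * y) * indicator {u..v} y) \<partial>lborel)"
    using uv d by (intro nn_integral_cong) (auto simp: indicator_def ennreal_mult)
  also have "\<dots> = ennreal (\<integral>y. (0 + d * y) * indicator {u..v} y \<partial>lborel)"
    using I(1) uv d by (intro nn_integral_eq_integral) (auto simp: indicator_def)
  also have "(\<integral>y. (0 + d * y) * indicator {u..v} y \<partial>lborel) = q * (u + v) / 2"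
  proof -
    have "d * (v\<^sup>2 - u\<^sup>2) = (d * (v - u)) * (u + v)" by (simp add: power2_eq_square algebra_simps)
    also have "d * (v - u) = q" using uv by (simp add: d_def)
    finally show ?thesis using I(2) uv by simp
  qed
  also have "ennreal (1 - q) * ennreal c + ennreal (q * (u + v) / 2) = ennreal ((1 - q) * c + q * (u + v) / 2)"
    using q c uv by (subst ennreal_plus) (auto simp: ennreal_mult)
  finally have "(\<integral>\<^sup>+\<omega>. E \<omega> \<partial>M) \<le> 1" using mean by simp
  then have Ev: "E \<in> evars M" by (simp add: evars_def)
  have apd0: "atom_plus_density_on {ennreal 0..} (distr M borel E) c (1 - q) (\<lambda>y. q / (v - u) * indicator {u..v} y)"
    by (rule atom_plus_density_on_subset[OF apd]) simp
  have "(LINT y:{t..}|lborel. q / (v - u) * indicator {u..v} y) = (\<integral>y. (d + 0 * y) * indicator {t..v} y \<partial>lborel)"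
    unfolding set_lebesgue_integral_def
    using t by (intro Bochner_Integration.integral_cong) (auto simp: d_def indicator_def)
  also have "\<dots> = q * (v - t) / (v - u)"
    using affine_interval_integral(2)[OF t(2), of d 0] by (simp add: d_def)
  finally show ?thesis using apd Ev evar_density_facts(4)[OF M(1) Ev apd0 order_refl c, of t] t uv
    by auto
qed

text \<open>The constant \<open>1\<close>, with the threshold in the form \<open>1 / \<gamma>\<close> for \<open>\<gamma> = 1\<close>.\<close>

lemma point_evar_exists:
  assumes M: "prob_space M" "atomless M"
  shows "\<exists>E\<in>evars M. atom_plus_density_on UNIV (distr M borel E) 1 1 (\<lambda>_. 0) \<and>
    measure M {\<omega>\<in>space M. ennreal (1 / 1) \<le> E \<omega>} = 1"
  using point_uniform_evar_exists[OF M, of 0 1 0 1 1] by simp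

text \<open>Identifies the left endpoint of the support for the extremal decreasing laws, which have an atom
  there.\<close>

lemma Inf_msupport_eq_atom:
  assumes apd: "atom_plus_density_on UNIV \<mu> c p f" and sets: "sets \<mu> = sets borel"
    and p: "0 < p" and c: "0 \<le> c" and f: "\<And>y. y < c \<Longrightarrow> f y = 0"
  shows "Inf (msupport \<mu>) = ennreal c"
proof (rule Inf_eqI)
  fix y assume y: "y \<in> msupport \<mu>"
  show "ennreal c \<le> y"
  proof (rule ccontr)
    assume "\<not> ennreal c \<le> y"
    then have "0 < emeasure \<mu> {..<ennreal c}" using y by (auto simp: msupport_def)
    moreover have "(\<integral>\<^sup>+t\<in>{0..}. ennreal (f t) * indicator {..<ennreal c} (ennreal t) \<partial>lborel) = (\<integral>\<^sup>+(t::real). 0 \<partial>lborel)"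
      using f by (intro nn_integral_cong) (auto simp: indicator_def ennreal_less_iff)
    then have "emeasure \<mu> {..<ennreal c} = 0"
      using apd by (auto simp: atom_plus_density_on_def)
    ultimately show False by simp
  qed
next
  fix y assume le: "\<And>i. i \<in> msupport \<mu> \<Longrightarrow> y \<le> i"
  have "ennreal c \<in> msupport \<mu>"
    unfolding msupport_def
  proof (intro CollectI allI impI)
    fix U assume U: "open U \<and> ennreal c \<in> U"
    then have "ennreal p * indicator U (ennreal c) \<le> emeasure \<mu> U"
      using apd by (auto simp: atom_plus_density_on_def)
    moreover have "0 < ennreal p * indicator U (ennreal c)" using U p by simp
    ultimately show "0 < emeasure \<mu> U" by (rule order_less_le_trans[rotated])
  qed
  then show "y \<le> ennreal c" by (rule le)
qed

section \<open>The suprema\<close>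

lemma R_eqI:
  assumes "prob_space M" and upper: "\<And>E. E \<in> S \<Longrightarrow> measure M {\<omega>\<in>space M. ennreal (1 / \<gamma>) \<le> E \<omega>} \<le> r"
    and attained: "\<exists>E\<in>S. measure M {\<omega>\<in>space M. ennreal (1 / \<gamma>) \<le> E \<omega>} = r"
  shows "R M \<gamma> S = r"
  unfolding R_def using upper attained
  by (intro cSup_eq_maximum) (auto simp: image_iff)

text \<open>The bound is attained by mass \<open>1 - \<gamma>\<close> at \<open>0\<close> and mass \<open>\<gamma>\<close> spread uniformly over \<open>[0, 2 / \<gamma>]\<close>.
  For \<open>\<gamma> = 1\<close> the left endpoint of the support may equal the threshold, and the constant \<open>1\<close> beats
  this bound.\<close>

lemma R_evars_D:
  assumes M: "prob_space M" "atomless M" and \<gamma>: "0 < \<gamma>" "\<gamma> < 1"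
  shows "R M \<gamma> (evars_D M) = \<gamma> / 2"
proof (rule R_eqI[OF M(1)])
  have t: "1 < 1 / \<gamma>" using \<gamma> by simp
  show "measure M {\<omega>\<in>space M. ennreal (1 / \<gamma>) \<le> E \<omega>} \<le> \<gamma> / 2" if "E \<in> evars_D M" for E
    using evars_D_tail_le[OF M(1) that t] by simp
  obtain E where E: "E \<in> evars M"
    "atom_plus_density_on UNIV (distr M borel E) 0 (1 - \<gamma>) (\<lambda>y. \<gamma> / (2 / \<gamma> - 0) * indicator {0..2 / \<gamma>} y)"
    "measure M {\<omega>\<in>space M. ennreal (1 / \<gamma>) \<le> E \<omega>}
      = (1 - \<gamma>) * indicator {1 / \<gamma>..} 0 + \<gamma> * (2 / \<gamma> - 1 / \<gamma>) / (2 / \<gamma> - 0)"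
    using point_uniform_evar_exists[OF M, of \<gamma> 0 0 "2 / \<gamma>" "1 / \<gamma>"] \<gamma> by (auto simp: field_simps)
  have "Inf (msupport (distr M borel E)) = ennreal 0"
    by (rule Inf_msupport_eq_atom[OF E(2)]) (use \<gamma> in auto)
  moreover have "antimono_on {0<..} (\<lambda>y. \<gamma> / (2 / \<gamma> - 0) * indicator {0..2 / \<gamma>} y)"
    using \<gamma> by (auto simp: monotone_on_def indicator_def)
  ultimately have "E \<in> evars_D M" using E(1,2) unfolding evars_D_def by blast
  moreover have "measure M {\<omega>\<in>space M. ennreal (1 / \<gamma>) \<le> E \<omega>} = \<gamma> / 2"
    using E(3) \<gamma> by (simp add: indicator_def field_simps)
  ultimately show "\<exists>E\<in>evars_D M. measure M {\<omega>\<in>space M. ennreal (1 / \<gamma>) \<le> E \<omega>} = \<gamma> / 2"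
    by blast
qed

lemma R_one_evars_D:
  assumes M: "prob_space M" "atomless M"
  shows "R M 1 (evars_D M) = 1"
proof (rule R_eqI[OF M(1)])
  interpret prob_space M by fact
  show "measure M {\<omega>\<in>space M. ennreal (1 / 1) \<le> E \<omega>} \<le> 1" for E by simp
  obtain E where E: "E \<in> evars M" "atom_plus_density_on UNIV (distr M borel E) 1 1 (\<lambda>_. 0)"
    "measure M {\<omega>\<in>space M. ennreal (1 / 1) \<le> E \<omega>} = 1"
    using point_evar_exists[OF M] by blast
  have "Inf (msupport (distr M borel E)) = ennreal 1"
    by (rule Inf_msupport_eq_atom[OF E(2)]) auto
  moreover have "antimono_on {1<..} (\<lambda>_::real. 0::real)" by (simp add: monotone_on_def)
  ultimately have "E \<in> evars_D M" using E(1,2) zero_le_one unfolding evars_D_def by blast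
  then show "\<exists>E\<in>evars_D M. measure M {\<omega>\<in>space M. ennreal (1 / 1) \<le> E \<omega>} = 1" using E(3) by blast
qed

text \<open>The bound is attained by mixing a point mass at \<open>0\<close>, which the shape constraint does not see, with the
  uniform distribution on \<open>[1, b]\<close>, where \<open>b\<close> is the touching point of the dual certificate. As
  \<open>\<gamma>\<close> tends to \<open>1\<close> this interval shrinks to the point \<open>1\<close>, so \<open>\<gamma> = 1\<close> is treated by the constant
  \<open>1\<close>.\<close>

lemma R_evars_D_gt1:
  assumes M: "prob_space M" "atomless M" and \<gamma>: "0 < \<gamma>" "\<gamma> \<le> 1"
  shows "R M \<gamma> (evars_D_gt1 M) = \<gamma> / (1 + sqrt (1 - \<gamma>\<^sup>2))"
proof (cases "\<gamma> = 1")
  case True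
  interpret prob_space M by fact
  obtain E where E: "E \<in> evars M" "atom_plus_density_on UNIV (distr M borel E) 1 1 (\<lambda>_. 0)"
    "measure M {\<omega>\<in>space M. ennreal (1 / 1) \<le> E \<omega>} = 1"
    using point_evar_exists[OF M] by blast
  have "antimono_on {1<..} (\<lambda>_::real. 0::real)" by (simp add: monotone_on_def)
  then have "E \<in> evars_D_gt1 M"
    using E(1) atom_plus_density_on_subset[OF E(2) subset_UNIV] unfolding evars_D_gt1_def by blast
  then have "R M 1 (evars_D_gt1 M) = 1" using E(3) by (intro R_eqI[OF M(1)]) auto
  then show ?thesis using True by simp
next
  case False
  define t where "t = 1 / \<gamma>"
  define b where "b = t + sqrt (t\<^sup>2 - 1)"
  have t: "1 < t" using \<gamma> False by (simp add: t_def)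
  have pos: "0 < t\<^sup>2 - 1" using t by (simp add: one_less_power)
  then have b: "t < b" "b\<^sup>2 - 1 = 2 * b * (b - t)"
    by (auto simp: b_def power2_eq_square algebra_simps)
  have val: "\<gamma> / (1 + sqrt (1 - \<gamma>\<^sup>2)) = 1 / b"
  proof -
    have "sqrt (t\<^sup>2 - 1) = sqrt ((1 - \<gamma>\<^sup>2) / \<gamma>\<^sup>2)"
      using \<gamma> by (simp add: t_def power_divide diff_divide_distrib)
    also have "\<dots> = sqrt (1 - \<gamma>\<^sup>2) / \<gamma>" using \<gamma> by (simp add: real_sqrt_divide)
    finally have "b = (1 + sqrt (1 - \<gamma>\<^sup>2)) / \<gamma>" by (simp add: b_def t_def add_divide_distrib)
    then show ?thesis by simp
  qed
  show ?thesis
    unfolding val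
  proof (rule R_eqI[OF M(1)]; unfold t_def[symmetric])
    show "measure M {\<omega>\<in>space M. ennreal t \<le> E \<omega>} \<le> 1 / b" if "E \<in> evars_D_gt1 M" for E
      using evars_D_gt1_tail_le[OF M(1) that t] by (simp add: b_def)
    \<comment> \<open>the weight for which the mean is exactly one\<close>
    define q where "q = 2 / (1 + b)"
    have q: "0 \<le> q" "q \<le> 1" "q * (1 + b) = 2" using b t by (auto simp: q_def simp del: distrib_left_numeral)
    obtain E where E: "E \<in> evars M"
      "atom_plus_density_on UNIV (distr M borel E) 0 (1 - q) (\<lambda>y. q / (b - 1) * indicator {1..b} y)"
      "measure M {\<omega>\<in>space M. ennreal t \<le> E \<omega>} = (1 - q) * indicator {t..} 0 + q * (b - t) / (b - 1)"
      using point_uniform_evar_exists[OF M q(1,2), of 0 1 b t] b t q by auto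
    have "atom_plus_density_on {1..} (distr M borel E) 1 0 (\<lambda>y. q / (b - 1) * indicator {1..b} y)"
      using E(2) unfolding atom_plus_density_on_def by (auto simp: indicator_def subset_iff)
    moreover have "antimono_on {1<..} (\<lambda>y. q / (b - 1) * indicator {1..b} y)"
      using q b t by (auto simp: monotone_on_def indicator_def)
    ultimately have "E \<in> evars_D_gt1 M" using E(1) unfolding evars_D_gt1_def by blast
    moreover have "measure M {\<omega>\<in>space M. ennreal t \<le> E \<omega>} = 1 / b"
    proof -
      have "b * (q * (b - t)) = b - 1"
      proof -
        have "(1 + b) * (b * (q * (b - t))) = (q * (1 + b)) * (b * (b - t))" by simp
        also have "\<dots> = b\<^sup>2 - 1" unfolding q(3) b(2) by simp
        also have "\<dots> = (1 + b) * (b - 1)" by (simp add: power2_eq_square algebra_simps)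
        finally show ?thesis using b t by simp
      qed
      then have "q * (b - t) / (b - 1) = 1 / b" using b t by (subst frac_eq_eq) (auto simp: mult.commute)
      then show ?thesis using E(3) t by (simp add: indicator_def)
    qed
    ultimately show "\<exists>E\<in>evars_D_gt1 M. measure M {\<omega>\<in>space M. ennreal t \<le> E \<omega>} = 1 / b" by blast
  qed
qed

text \<open>The two values of the maximum come from the extreme positions of the mode: mode \<open>0\<close> with the law used
  for decreasing densities, and mode \<open>1 / \<gamma>\<close> with mass \<open>2 * \<gamma> - 1\<close> at the threshold itself and the
  remaining mass uniform below it.\<close>

lemma R_evars_U:
  assumes M: "prob_space M" "atomless M" and \<gamma>: "0 < \<gamma>" "\<gamma> \<le> 1"
  shows "R M \<gamma> (evars_U M) = max (\<gamma> / 2) (2 * \<gamma> - 1)"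
proof (rule R_eqI[OF M(1)])
  have t: "1 \<le> 1 / \<gamma>" using \<gamma> by simp
  show "measure M {\<omega>\<in>space M. ennreal (1 / \<gamma>) \<le> E \<omega>} \<le> max (\<gamma> / 2) (2 * \<gamma> - 1)"
    if "E \<in> evars_U M" for E
    using evars_U_tail_le[OF M(1) that t] by simp
  have "\<exists>E\<in>evars_U M. measure M {\<omega>\<in>space M. ennreal (1 / \<gamma>) \<le> E \<omega>} = \<gamma> / 2"
  proof -
    obtain E where E: "E \<in> evars M"
      "atom_plus_density_on UNIV (distr M borel E) 0 (1 - \<gamma>) (\<lambda>y. \<gamma> / (2 / \<gamma> - 0) * indicator {0..2 / \<gamma>} y)"
      "measure M {\<omega>\<in>space M. ennreal (1 / \<gamma>) \<le> E \<omega>}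
        = (1 - \<gamma>) * indicator {1 / \<gamma>..} 0 + \<gamma> * (2 / \<gamma> - 1 / \<gamma>) / (2 / \<gamma> - 0)"
      using point_uniform_evar_exists[OF M, of \<gamma> 0 0 "2 / \<gamma>" "1 / \<gamma>"] \<gamma> by (auto simp: field_simps)
    have "mono_on {0..<0} (\<lambda>y. \<gamma> / (2 / \<gamma> - 0) * indicator {0..2 / \<gamma>} y)"
      "antimono_on {0<..} (\<lambda>y. \<gamma> / (2 / \<gamma> - 0) * indicator {0..2 / \<gamma>} y)"
      using \<gamma> by (auto simp: monotone_on_def indicator_def)
    then have "E \<in> evars_U M" using E(1,2) unfolding evars_U_def by blast
    moreover have "measure M {\<omega>\<in>space M. ennreal (1 / \<gamma>) \<le> E \<omega>} = \<gamma> / 2"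
      using E(3) \<gamma> by (simp add: indicator_def field_simps)
    ultimately show ?thesis by blast
  qed
  moreover have "\<exists>E\<in>evars_U M. measure M {\<omega>\<in>space M. ennreal (1 / \<gamma>) \<le> E \<omega>} = 2 * \<gamma> - 1"
    if half: "1 \<le> 2 * \<gamma>"
  proof -
    \<comment> \<open>the weight of the uniform component for which the mean is exactly one\<close>
    define q where "q = 2 - 2 * \<gamma>"
    have q: "0 \<le> q" "q \<le> 1" using half \<gamma> by (auto simp: q_def)
    have mean: "(1 - q) * (1 / \<gamma>) + q * (0 + 1 / \<gamma>) / 2 \<le> 1" using \<gamma> by (simp add: q_def field_simps)
    obtain E where E: "E \<in> evars M"
      "atom_plus_density_on UNIV (distr M borel E) (1 / \<gamma>) (1 - q) (\<lambda>y. q / (1 / \<gamma> - 0) * indicator {0..1 / \<gamma>} y)"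
      "measure M {\<omega>\<in>space M. ennreal (1 / \<gamma>) \<le> E \<omega>}
        = (1 - q) * indicator {1 / \<gamma>..} (1 / \<gamma>) + q * (1 / \<gamma> - 1 / \<gamma>) / (1 / \<gamma> - 0)"
      using point_uniform_evar_exists[OF M q _ _ _ _ _ mean, of "1 / \<gamma>"] \<gamma> by auto
    have "mono_on {0..<1 / \<gamma>} (\<lambda>y. q / (1 / \<gamma> - 0) * indicator {0..1 / \<gamma>} y)"
      "antimono_on {1 / \<gamma><..} (\<lambda>y. q / (1 / \<gamma> - 0) * indicator {0..1 / \<gamma>} y)"
      by (auto simp: monotone_on_def indicator_def)
    moreover have "0 \<le> 1 / \<gamma>" using \<gamma> by simp
    ultimately have "E \<in> evars_U M" using E(1,2) unfolding evars_U_def by blast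
    then show ?thesis using E(3) by (auto simp: q_def)
  qed
  ultimately show "\<exists>E\<in>evars_U M. measure M {\<omega>\<in>space M. ennreal (1 / \<gamma>) \<le> E \<omega>} = max (\<gamma> / 2) (2 * \<gamma> - 1)"
    using \<gamma> by (cases "2 * \<gamma> - 1 \<le> \<gamma> / 2") (auto simp: max_def)
qed

theorem theorem2:
  fixes M :: "'a measure" and \<gamma> :: real
  assumes "prob_space M" and "atomless M"
    and "0 < \<gamma>" and "\<gamma> \<le> 1"
  shows "(\<gamma> \<noteq> 1 \<longrightarrow> R M \<gamma> (evars_D M) = \<gamma> / 2) \<and> R M 1 (evars_D M) = 1 \<and>
    R M \<gamma> (evars_D_gt1 M) = \<gamma> / (1 + sqrt (1 - \<gamma>\<^sup>2)) \<and>
    R M \<gamma> (evars_U M) = max (\<gamma> / 2) (2 * \<gamma> - 1)"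
  using R_evars_D[OF assms(1-3)] R_one_evars_D[OF assms(1,2)]
    R_evars_D_gt1[OF assms] R_evars_U[OF assms] assms(4) by simp

end
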